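(* If $\mathcal{Q}$ is a (possibly large) Girard quantaloid, then $\mathbf{Arr}(\mathcal{Q})$ and $\mathbf{ChuCon}(\mathcal{Q})$ are isomorphic quantaloids and, consequently, $\mathbf{D}(\mathcal{Q})$ and $\mathbf{B}(\mathcal{Q})$ are isomorphic quantaloids.
   Context: A quantaloid is a (possibly large) category whose hom-sets are complete lattices and whose composition preserves arbitrary joins in each variable. For arrows $u:p\to q$, $v:q\to r$, $w:p\to r$ the arrows $w\swarrow u:q\to r$ and $v\searrow w:p\to q$ are determined by $v\circ u\le w\iff v\le w\swarrow u\iff u\le v\searrow w$. A homomorphism of quantaloids is a functor preserving joins of arrows; it is an isomorphism if the underlying functor is an isomorphism of categories. A congruence on a quantaloid is a family of equivalence relations on the hom-sets compatible with composition and arbitrary joins; it induces a quotient quantaloid with the same objects and with equivalence classes as arrows. A quantaloid $\mathcal{Q}$ is Girard if it is equipped with a family of arrows $\{d_q:q\to q\}_{q\in\mathrm{ob}\,\mathcal{Q}}$ that is cyclic, i.e. $d_p\swarrow u=u\searrow d_q$ for all $u:p\to q$, and dualizing, i.e. $(d_p\swarrow u)\searrow d_p=u=d_q\swarrow(u\searrow d_q)$ for all $u:p\to q$. $\mathbf{Arr}(\mathcal{Q})$: objects are $\mathcal{Q}$-arrows; arrows from $u:p\to q$ to $v:p'\to q'$ are pairs $(s:p\to p',t:q\to q')$ with $v\circ s=t\circ u$; composition and order are componentwise. $\mathbf{D}(\mathcal{Q}):=\mathbf{Arr}(\mathcal{Q})/\!\sim$, where $(s,t)\sim(s',t'):u\to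 v$ iff $v\circ s=t\circ u=v\circ s'=t'\circ u$. $\mathbf{ChuCon}(\mathcal{Q})$: objects are $\mathcal{Q}$-arrows; arrows from $u:p\to q$ to $v:p'\to q'$ are Chu connections, i.e. pairs $(s:p\to p',t:q\to q')$ with $u\swarrow s=t\searrow v$; composition and order are componentwise. $\mathbf{B}(\mathcal{Q}):=\mathbf{ChuCon}(\mathcal{Q})/\!\sim$, where $(s,t)\sim(s',t'):u\to v$ iff $u\swarrow s=t\searrow v=u\swarrow s'=t'\searrow v$. *)

theory Defs
  imports "HOL-Algebra.Complete_Lattice"
begin

section \<open>Quantaloids\<close>

text \<open>
  The hom-sets need not be disjoint, so an arrow is only determined together with its domain and
  codomain; operations on arrows therefore take the objects involved as arguments:
  \<open>Comp Q p q r v u\<close> is the composite \<open>v \<circ> u\<close> of \<open>u : p \<rightarrow> q\<close> and \<open>v : q \<rightarrow> r\<close>. Each hom-set is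
  an ordered set in the sense of \<^theory>\<open>HOL-Algebra.Order\<close>.
\<close>

record ('o, 'a) quantaloid_data =
  Ob :: "'o set"
  Hom :: "'o \<Rightarrow> 'o \<Rightarrow> 'a gorder"
  Comp :: "'o \<Rightarrow> 'o \<Rightarrow> 'o \<Rightarrow> 'a \<Rightarrow> 'a \<Rightarrow> 'a"
  Ide :: "'o \<Rightarrow> 'a"

abbreviation Arrows :: "('o, 'a) quantaloid_data \<Rightarrow> 'o \<Rightarrow> 'o \<Rightarrow> 'a set"
  where "Arrows Q p q \<equiv> carrier (Hom Q p q)"

locale quantaloid =
  fixes Q :: "('o, 'a) quantaloid_data"
  assumes comp_closed:
      "\<lbrakk>p \<in> Ob Q; q \<in> Ob Q; r \<in> Ob Q; u \<in> Arrows Q p q; v \<in> Arrows Q q r\<rbrakk>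
        \<Longrightarrow> Comp Q p q r v u \<in> Arrows Q p r"
    and id_closed: "p \<in> Ob Q \<Longrightarrow> Ide Q p \<in> Arrows Q p p"
    and comp_id_right:
      "\<lbrakk>p \<in> Ob Q; q \<in> Ob Q; u \<in> Arrows Q p q\<rbrakk> \<Longrightarrow> Comp Q p p q u (Ide Q p) = u"
    and comp_id_left:
      "\<lbrakk>p \<in> Ob Q; q \<in> Ob Q; u \<in> Arrows Q p q\<rbrakk> \<Longrightarrow> Comp Q p q q (Ide Q q) u = u"
    and comp_assoc:
      "\<lbrakk>p \<in> Ob Q; q \<in> Ob Q; r \<in> Ob Q; s \<in> Ob Q;
        u \<in> Arrows Q p q; v \<in> Arrows Q q r; w \<in> Arrows Q r s\<rbrakk>
        \<Longrightarrow> Comp Q p r s w (Comp Q p q r v u) = Comp Q p q s (Comp Q q r s w v) u"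
    and hom_complete_lattice:
      "\<lbrakk>p \<in> Ob Q; q \<in> Ob Q\<rbrakk> \<Longrightarrow> complete_lattice (Hom Q p q)"
    and comp_sup_right:
      "\<lbrakk>p \<in> Ob Q; q \<in> Ob Q; r \<in> Ob Q; v \<in> Arrows Q q r\<rbrakk>
        \<Longrightarrow> sup_pres (Hom Q p q) (Hom Q p r) (\<lambda>u. Comp Q p q r v u)"
    and comp_sup_left:
      "\<lbrakk>p \<in> Ob Q; q \<in> Ob Q; r \<in> Ob Q; u \<in> Arrows Q p q\<rbrakk>
        \<Longrightarrow> sup_pres (Hom Q q r) (Hom Q p r) (\<lambda>v. Comp Q p q r v u)"

text \<open>
  For \<open>u : p \<rightarrow> q\<close>, \<open>v : q \<rightarrow> r\<close>, \<open>w : p \<rightarrow> r\<close>: \<open>lres Q p q r w u\<close> is \<open>w \<swarrow> u : q \<rightarrow> r\<close> and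
  \<open>rres Q p q r v w\<close> is \<open>v \<searrow> w : p \<rightarrow> q\<close>.
\<close>

definition lres :: "('o, 'a) quantaloid_data \<Rightarrow> 'o \<Rightarrow> 'o \<Rightarrow> 'o \<Rightarrow> 'a \<Rightarrow> 'a \<Rightarrow> 'a"
  where "lres Q p q r w u =
    (THE x. x \<in> Arrows Q q r \<and>
      (\<forall>v \<in> Arrows Q q r. Comp Q p q r v u \<sqsubseteq>\<^bsub>Hom Q p r\<^esub> w \<longleftrightarrow> v \<sqsubseteq>\<^bsub>Hom Q q r\<^esub> x))"

definition rres :: "('o, 'a) quantaloid_data \<Rightarrow> 'o \<Rightarrow> 'o \<Rightarrow> 'o \<Rightarrow> 'a \<Rightarrow> 'a \<Rightarrow> 'a"
  where "rres Q p q r v w =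
    (THE x. x \<in> Arrows Q p q \<and>
      (\<forall>u \<in> Arrows Q p q. Comp Q p q r v u \<sqsubseteq>\<^bsub>Hom Q p r\<^esub> w \<longleftrightarrow> u \<sqsubseteq>\<^bsub>Hom Q p q\<^esub> x))"

lemma sup_pres_adjoint:
  assumes f: "sup_pres X Y f" "f \<in> carrier X \<rightarrow> carrier Y" and w: "w \<in> carrier Y"
  shows "\<exists>!x. x \<in> carrier X \<and> (\<forall>a \<in> carrier X. f a \<sqsubseteq>\<^bsub>Y\<^esub> w \<longleftrightarrow> a \<sqsubseteq>\<^bsub>X\<^esub> x)"
proof -
  interpret X: complete_lattice X using f(1) by (simp add: sup_pres_def)
  interpret Y: complete_lattice Y using f(1) by (simp add: sup_pres_def)
  have closed: "f a \<in> carrier Y" if "a \<in> carrier X" for a using f(2) that by blast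
  define S where "S = {a \<in> carrier X. f a \<sqsubseteq>\<^bsub>Y\<^esub> w}"
  have S: "S \<subseteq> carrier X" by (auto simp: S_def)
  have x: "\<Squnion>\<^bsub>X\<^esub> S \<in> carrier X" using S by simp
  have fS: "f (\<Squnion>\<^bsub>X\<^esub> S) = \<Squnion>\<^bsub>Y\<^esub> (f ` S)" using f(1) S by (auto simp: sup_pres_def)
  have le: "f (\<Squnion>\<^bsub>X\<^esub> S) \<sqsubseteq>\<^bsub>Y\<^esub> w"
    unfolding fS using S closed w by (intro Y.sup_least) (auto simp: S_def)
  have mono: "f a \<sqsubseteq>\<^bsub>Y\<^esub> f b" if ab: "a \<in> carrier X" "b \<in> carrier X" "a \<sqsubseteq>\<^bsub>X\<^esub> b" for a b
  proof -
    have "\<Squnion>\<^bsub>X\<^esub> {a, b} = b"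
      by (rule X.le_antisym)
        (use ab in \<open>auto intro!: X.sup_least X.sup_upper\<close>)
    then have "f b = \<Squnion>\<^bsub>Y\<^esub> {f a, f b}"
      using f(1) ab unfolding sup_pres_def by (metis empty_subsetI image_empty image_insert insert_subset)
    moreover have "f a \<sqsubseteq>\<^bsub>Y\<^esub> \<Squnion>\<^bsub>Y\<^esub> {f a, f b}"
      using ab closed by (intro Y.sup_upper) auto
    ultimately show ?thesis by simp
  qed
  have adj: "f a \<sqsubseteq>\<^bsub>Y\<^esub> w \<longleftrightarrow> a \<sqsubseteq>\<^bsub>X\<^esub> \<Squnion>\<^bsub>X\<^esub> S" if a: "a \<in> carrier X" for a
  proof
    assume "f a \<sqsubseteq>\<^bsub>Y\<^esub> w"
    then show "a \<sqsubseteq>\<^bsub>X\<^esub> \<Squnion>\<^bsub>X\<^esub> S" using a S by (intro X.sup_upper) (auto simp: S_def)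
  next
    assume "a \<sqsubseteq>\<^bsub>X\<^esub> \<Squnion>\<^bsub>X\<^esub> S"
    then have "f a \<sqsubseteq>\<^bsub>Y\<^esub> f (\<Squnion>\<^bsub>X\<^esub> S)" using a x by (intro mono)
    then show "f a \<sqsubseteq>\<^bsub>Y\<^esub> w" using le a x w closed by (meson Y.le_trans)
  qed
  show ?thesis
  proof (rule ex1I[of _ "\<Squnion>\<^bsub>X\<^esub> S"])
    fix y assume y: "y \<in> carrier X \<and> (\<forall>a \<in> carrier X. f a \<sqsubseteq>\<^bsub>Y\<^esub> w \<longleftrightarrow> a \<sqsubseteq>\<^bsub>X\<^esub> y)"
    have "y \<sqsubseteq>\<^bsub>X\<^esub> \<Squnion>\<^bsub>X\<^esub> S" using y adj[of y] by auto
    moreover have "\<Squnion>\<^bsub>X\<^esub> S \<sqsubseteq>\<^bsub>X\<^esub> y" using y le x by auto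
    ultimately show "y = \<Squnion>\<^bsub>X\<^esub> S" using y x by (intro X.le_antisym) auto
  qed (use x adj in auto)
qed

context quantaloid
begin

lemma lres:
  assumes "p \<in> Ob Q" "q \<in> Ob Q" "r \<in> Ob Q" "u \<in> Arrows Q p q" "w \<in> Arrows Q p r"
  shows lres_closed: "lres Q p q r w u \<in> Arrows Q q r"
    and lres_adjoint: "v \<in> Arrows Q q r \<Longrightarrow>
      Comp Q p q r v u \<sqsubseteq>\<^bsub>Hom Q p r\<^esub> w \<longleftrightarrow> v \<sqsubseteq>\<^bsub>Hom Q q r\<^esub> lres Q p q r w u"
proof -
  have "(\<lambda>v. Comp Q p q r v u) \<in> Arrows Q q r \<rightarrow> Arrows Q p r"
    using assms comp_closed by auto
  from theI'[OF sup_pres_adjoint[OF comp_sup_left[OF assms(1-4)] this assms(5)]]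
  show "lres Q p q r w u \<in> Arrows Q q r"
    and "v \<in> Arrows Q q r \<Longrightarrow>
      Comp Q p q r v u \<sqsubseteq>\<^bsub>Hom Q p r\<^esub> w \<longleftrightarrow> v \<sqsubseteq>\<^bsub>Hom Q q r\<^esub> lres Q p q r w u"
    unfolding lres_def by auto
qed

lemma rres:
  assumes "p \<in> Ob Q" "q \<in> Ob Q" "r \<in> Ob Q" "v \<in> Arrows Q q r" "w \<in> Arrows Q p r"
  shows rres_closed: "rres Q p q r v w \<in> Arrows Q p q"
    and rres_adjoint: "u \<in> Arrows Q p q \<Longrightarrow>
      Comp Q p q r v u \<sqsubseteq>\<^bsub>Hom Q p r\<^esub> w \<longleftrightarrow> u \<sqsubseteq>\<^bsub>Hom Q p q\<^esub> rres Q p q r v w"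
proof -
  have "(\<lambda>u. Comp Q p q r v u) \<in> Arrows Q p q \<rightarrow> Arrows Q p r"
    using assms comp_closed by auto
  from theI'[OF sup_pres_adjoint[OF comp_sup_right[OF assms(1-4)] this assms(5)]]
  show "rres Q p q r v w \<in> Arrows Q p q"
    and "u \<in> Arrows Q p q \<Longrightarrow>
      Comp Q p q r v u \<sqsubseteq>\<^bsub>Hom Q p r\<^esub> w \<longleftrightarrow> u \<sqsubseteq>\<^bsub>Hom Q p q\<^esub> rres Q p q r v w"
    unfolding rres_def by auto
qed

end

locale girard_quantaloid = quantaloid Q for Q :: "('o, 'a) quantaloid_data" +
  fixes d :: "'o \<Rightarrow> 'a"
  assumes d_closed: "q \<in> Ob Q \<Longrightarrow> d q \<in> Arrows Q q q"
    and cyclic: "\<lbrakk>p \<in> Ob Q; q \<in> Ob Q; u \<in> Arrows Q p q\<rbrakk>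
      \<Longrightarrow> lres Q p q p (d p) u = rres Q q p q u (d q)"
    and dualizing_right: "\<lbrakk>p \<in> Ob Q; q \<in> Ob Q; u \<in> Arrows Q p q\<rbrakk>
      \<Longrightarrow> rres Q p q p (lres Q p q p (d p) u) (d p) = u"
    and dualizing_left: "\<lbrakk>p \<in> Ob Q; q \<in> Ob Q; u \<in> Arrows Q p q\<rbrakk>
      \<Longrightarrow> lres Q q p q (d q) (rres Q q p q u (d q)) = u"


section \<open>Homomorphisms and isomorphisms\<close>

text \<open>
  A functor is given by its object part \<open>F\<close> and its arrow part \<open>f\<close>, where \<open>f p q u\<close> is the image of
  \<open>u : p \<rightarrow> q\<close>. The values of \<open>F\<close> and \<open>f\<close> outside the objects and arrows of \<open>Q\<close> are irrelevant.
\<close>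

definition is_functor ::
  "('o, 'a) quantaloid_data \<Rightarrow> ('p, 'b) quantaloid_data \<Rightarrow> ('o \<Rightarrow> 'p) \<Rightarrow> ('o \<Rightarrow> 'o \<Rightarrow> 'a \<Rightarrow> 'b) \<Rightarrow> bool"
  where "is_functor Q R F f \<longleftrightarrow>
    F \<in> Ob Q \<rightarrow> Ob R \<and>
    (\<forall>p \<in> Ob Q. \<forall>q \<in> Ob Q. f p q \<in> Arrows Q p q \<rightarrow> Arrows R (F p) (F q)) \<and>
    (\<forall>p \<in> Ob Q. f p p (Ide Q p) = Ide R (F p)) \<and>
    (\<forall>p \<in> Ob Q. \<forall>q \<in> Ob Q. \<forall>r \<in> Ob Q. \<forall>u \<in> Arrows Q p q. \<forall>v \<in> Arrows Q q r.
      f p r (Comp Q p q r v u) = Comp R (F p) (F q) (F r) (f q r v) (f p q u))"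

definition inverse_functors ::
  "('o, 'a) quantaloid_data \<Rightarrow> ('p, 'b) quantaloid_data \<Rightarrow> ('o \<Rightarrow> 'p) \<Rightarrow> ('o \<Rightarrow> 'o \<Rightarrow> 'a \<Rightarrow> 'b)
    \<Rightarrow> ('p \<Rightarrow> 'o) \<Rightarrow> ('p \<Rightarrow> 'p \<Rightarrow> 'b \<Rightarrow> 'a) \<Rightarrow> bool"
  where "inverse_functors Q R F f G g \<longleftrightarrow>
    (\<forall>p \<in> Ob Q. G (F p) = p) \<and>
    (\<forall>x \<in> Ob R. F (G x) = x) \<and>
    (\<forall>p \<in> Ob Q. \<forall>q \<in> Ob Q. \<forall>u \<in> Arrows Q p q. g (F p) (F q) (f p q u) = u) \<and>
    (\<forall>x \<in> Ob R. \<forall>y \<in> Ob R. \<forall>v \<in> Arrows R x y. f (G x) (G y) (g x y v) = v)"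

definition category_isomorphism ::
  "('o, 'a) quantaloid_data \<Rightarrow> ('p, 'b) quantaloid_data \<Rightarrow> ('o \<Rightarrow> 'p) \<Rightarrow> ('o \<Rightarrow> 'o \<Rightarrow> 'a \<Rightarrow> 'b) \<Rightarrow> bool"
  where "category_isomorphism Q R F f \<longleftrightarrow>
    is_functor Q R F f \<and> (\<exists>G g. is_functor R Q G g \<and> inverse_functors Q R F f G g)"

definition quantaloid_homomorphism ::
  "('o, 'a) quantaloid_data \<Rightarrow> ('p, 'b) quantaloid_data \<Rightarrow> ('o \<Rightarrow> 'p) \<Rightarrow> ('o \<Rightarrow> 'o \<Rightarrow> 'a \<Rightarrow> 'b) \<Rightarrow> bool"
  where "quantaloid_homomorphism Q R F f \<longleftrightarrow>
    quantaloid Q \<and> quantaloid R \<and> is_functor Q R F f \<and>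
    (\<forall>p \<in> Ob Q. \<forall>q \<in> Ob Q. sup_pres (Hom Q p q) (Hom R (F p) (F q)) (f p q))"

definition isomorphic_quantaloids ::
  "('o, 'a) quantaloid_data \<Rightarrow> ('p, 'b) quantaloid_data \<Rightarrow> bool"
  where "isomorphic_quantaloids Q R \<longleftrightarrow>
    quantaloid Q \<and> quantaloid R \<and>
    (\<exists>F f. quantaloid_homomorphism Q R F f \<and> category_isomorphism Q R F f)"


section \<open>Quotients by congruences\<close>

text \<open>
  Compatibility with joins: a family \<open>(a\<^sub>i, b\<^sub>i)\<close> of related pairs is given by the set \<open>S\<close> of its
  members.
\<close>

locale quantaloid_congruence = quantaloid Q for Q :: "('o, 'a) quantaloid_data" +
  fixes E :: "'o \<Rightarrow> 'o \<Rightarrow> ('a \<times> 'a) set"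
  assumes equiv: "\<lbrakk>p \<in> Ob Q; q \<in> Ob Q\<rbrakk> \<Longrightarrow> equiv (Arrows Q p q) (E p q)"
    and comp_cong: "\<lbrakk>p \<in> Ob Q; q \<in> Ob Q; r \<in> Ob Q; (u, u') \<in> E p q; (v, v') \<in> E q r\<rbrakk>
      \<Longrightarrow> (Comp Q p q r v u, Comp Q p q r v' u') \<in> E p r"
    and sup_cong: "\<lbrakk>p \<in> Ob Q; q \<in> Ob Q; S \<subseteq> E p q\<rbrakk>
      \<Longrightarrow> (\<Squnion>\<^bsub>Hom Q p q\<^esub> (fst ` S), \<Squnion>\<^bsub>Hom Q p q\<^esub> (snd ` S)) \<in> E p q"

text \<open>
  The quotient is meant for a congruence \<open>E\<close>: the union in \<open>Comp\<close> is then a single class. Joins in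
  the quotient are computed on representatives, so \<open>[a] \<le> [b]\<close> means \<open>[a \<squnion> b] = [b]\<close>.
\<close>

definition quotient_quantaloid ::
  "('o, 'a) quantaloid_data \<Rightarrow> ('o \<Rightarrow> 'o \<Rightarrow> ('a \<times> 'a) set) \<Rightarrow> ('o, 'a set) quantaloid_data"
  where "quotient_quantaloid Q E =
    \<lparr>Ob = Ob Q,
     Hom = (\<lambda>p q. \<lparr>carrier = Arrows Q p q // E p q, eq = (=),
                   le = (\<lambda>A B. \<exists>a \<in> A. \<exists>b \<in> B. a \<squnion>\<^bsub>Hom Q p q\<^esub> b \<in> B)\<rparr>),
     Comp = (\<lambda>p q r B A. \<Union>b \<in> B. \<Union>a \<in> A. E p r `` {Comp Q p q r b a}),
     Ide = (\<lambda>p. E p p `` {Ide Q p})\<rparr>"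


section \<open>The quantaloids constructed from \<open>Q\<close>\<close>

text \<open>
  Objects are the arrows \<open>u : p \<rightarrow> q\<close> of \<open>Q\<close>, recorded as triples \<open>(p, q, u)\<close>; arrows are those pairs
  \<open>(s : p \<rightarrow> p', t : q \<rightarrow> q')\<close> that satisfy the condition \<open>P\<close>.
\<close>

type_synonym ('o, 'a) arrow = "'o \<times> 'o \<times> 'a"

definition arrow_pairs ::
  "('o, 'a) quantaloid_data \<Rightarrow> (('o, 'a) arrow \<Rightarrow> ('o, 'a) arrow \<Rightarrow> 'a \<times> 'a \<Rightarrow> bool)
    \<Rightarrow> (('o, 'a) arrow, 'a \<times> 'a) quantaloid_data"
  where "arrow_pairs Q P =
    \<lparr>Ob = {(p, q, u). p \<in> Ob Q \<and> q \<in> Ob Q \<and> u \<in> Arrows Q p q},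
     Hom = (\<lambda>(p, q, u) (p', q', v).
       \<lparr>carrier = {(s, t). s \<in> Arrows Q p p' \<and> t \<in> Arrows Q q q' \<and> P (p, q, u) (p', q', v) (s, t)},
        eq = (=),
        le = (\<lambda>(s, t) (s', t'). s \<sqsubseteq>\<^bsub>Hom Q p p'\<^esub> s' \<and> t \<sqsubseteq>\<^bsub>Hom Q q q'\<^esub> t')\<rparr>),
     Comp = (\<lambda>(p, q, u) (p', q', v) (p'', q'', w) (s', t') (s, t).
       (Comp Q p p' p'' s' s, Comp Q q q' q'' t' t)),
     Ide = (\<lambda>(p, q, u). (Ide Q p, Ide Q q))\<rparr>"

definition Arr :: "('o, 'a) quantaloid_data \<Rightarrow> (('o, 'a) arrow, 'a \<times> 'a) quantaloid_data"
  where "Arr Q = arrow_pairs Q (\<lambda>(p, q, u) (p', q', v) (s, t).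
    Comp Q p p' q' v s = Comp Q p q q' t u)"

definition ChuCon :: "('o, 'a) quantaloid_data \<Rightarrow> (('o, 'a) arrow, 'a \<times> 'a) quantaloid_data"
  where "ChuCon Q = arrow_pairs Q (\<lambda>(p, q, u) (p', q', v) (s, t).
    lres Q p p' q u s = rres Q p' q q' t v)"

definition Arr_cong ::
  "('o, 'a) quantaloid_data \<Rightarrow> ('o, 'a) arrow \<Rightarrow> ('o, 'a) arrow \<Rightarrow> (('a \<times> 'a) \<times> ('a \<times> 'a)) set"
  where "Arr_cong Q = (\<lambda>(p, q, u) (p', q', v).
    {((s, t), (s', t')).
      (s, t) \<in> Arrows (Arr Q) (p, q, u) (p', q', v) \<and>
      (s', t') \<in> Arrows (Arr Q) (p, q, u) (p', q', v) \<and>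
      Comp Q p p' q' v s = Comp Q p q q' t u \<and>
      Comp Q p q q' t u = Comp Q p p' q' v s' \<and>
      Comp Q p p' q' v s' = Comp Q p q q' t' u})"

definition ChuCon_cong ::
  "('o, 'a) quantaloid_data \<Rightarrow> ('o, 'a) arrow \<Rightarrow> ('o, 'a) arrow \<Rightarrow> (('a \<times> 'a) \<times> ('a \<times> 'a)) set"
  where "ChuCon_cong Q = (\<lambda>(p, q, u) (p', q', v).
    {((s, t), (s', t')).
      (s, t) \<in> Arrows (ChuCon Q) (p, q, u) (p', q', v) \<and>
      (s', t') \<in> Arrows (ChuCon Q) (p, q, u) (p', q', v) \<and>
      lres Q p p' q u s = rres Q p' q q' t v \<and>
      rres Q p' q q' t v = lres Q p p' q u s' \<and>
      lres Q p p' q u s' = rres Q p' q q' t' v})"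

text \<open>
  \<open>DQ Q\<close> and \<open>BQ Q\<close> are the quotients \<open>\<^bold>D(Q)\<close> and \<open>\<^bold>B(Q)\<close> of \<open>Arr Q\<close> and \<open>ChuCon Q\<close>.
\<close>

definition DQ :: "('o, 'a) quantaloid_data \<Rightarrow> (('o, 'a) arrow, ('a \<times> 'a) set) quantaloid_data"
  where "DQ Q = quotient_quantaloid (Arr Q) (Arr_cong Q)"

definition BQ :: "('o, 'a) quantaloid_data \<Rightarrow> (('o, 'a) arrow, ('a \<times> 'a) set) quantaloid_data"
  where "BQ Q = quotient_quantaloid (ChuCon Q) (ChuCon_cong Q)"

end

theory Submission
  imports Defs
begin

text \<open>
  Write \<open>u\<^sup>\<bottom> = d\<^sub>p \<swarrow> u : q \<rightarrow> p\<close> for \<open>u : p \<rightarrow> q\<close>. The Girard axioms make \<open>u \<mapsto> u\<^sup>\<bottom>\<close> an involution with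
  \<open>u \<swarrow> s = (s \<circ> u\<^sup>\<bottom>)\<^sup>\<bottom>\<close> and \<open>t \<searrow> v = (v\<^sup>\<bottom> \<circ> t)\<^sup>\<bottom>\<close>. Hence \<open>(s, t)\<close> is a Chu connection from \<open>u\<close> to
  \<open>v\<close> iff \<open>(t, s)\<close> is a commutative square from \<open>u\<^sup>\<bottom>\<close> to \<open>v\<^sup>\<bottom>\<close>, and the isomorphism in both directions
  is \<open>u \<mapsto> u\<^sup>\<bottom>\<close> on objects and \<open>(s, t) \<mapsto> (t, s)\<close> on arrows. It matches the two congruences and so
  descends to the quotients.
\<close>

section \<open>Complete lattices and their quotients\<close>

lemma (in partial_order) sup_eqI:
  assumes "least L x (Upper L A)"
  shows "\<Squnion>A = x"
  unfolding sup_def by (rule some_equality) (use assms least_unique in auto)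

text \<open>The infimum of \<open>A\<close> arises as the supremum of its lower bounds. This reduces
  completeness of each new hom-set to the construction of joins.\<close>

lemma (in partial_order) complete_lattice_if_sups:
  assumes sups: "\<And>A. A \<subseteq> carrier L \<Longrightarrow> \<exists>x. least L x (Upper L A)"
  shows "complete_lattice L"
proof (rule complete_latticeI[OF sups])
  fix A assume A: "A \<subseteq> carrier L"
  obtain x where x: "least L x (Upper L (Lower L A))"
    using sups[OF Lower_closed] by blast
  have "greatest L x (Lower L A)"
  proof (rule greatest_LowerI)
    show "x \<sqsubseteq> a" if "a \<in> A" for a
      using x that A by (intro least_le[OF x] Upper_memI) auto
    show "y \<sqsubseteq> x" if "y \<in> Lower L A" for y
      using that by (intro least_Upper_above[OF x]) auto
  qed (use A x in auto)
  then show "\<exists>i. greatest L i (Lower L A)" ..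
qed

lemma partial_orderI:
  fixes L (structure)
  assumes "(.=) = (=)"
    and "\<And>x. x \<in> carrier L \<Longrightarrow> x \<sqsubseteq> x"
    and "\<And>x y. \<lbrakk>x \<in> carrier L; y \<in> carrier L; x \<sqsubseteq> y; y \<sqsubseteq> x\<rbrakk> \<Longrightarrow> x = y"
    and "\<And>x y z. \<lbrakk>x \<in> carrier L; y \<in> carrier L; z \<in> carrier L; x \<sqsubseteq> y; y \<sqsubseteq> z\<rbrakk> \<Longrightarrow> x \<sqsubseteq> z"
  shows "partial_order L"
proof unfold_locales
  show "(.=) = (=)" by fact
qed (simp_all add: assms(1), (use assms(2-) in blast)+)

lemma sup_pres_sup: "\<lbrakk>sup_pres X Y f; A \<subseteq> carrier X\<rbrakk> \<Longrightarrow> f (\<Squnion>\<^bsub>X\<^esub> A) = \<Squnion>\<^bsub>Y\<^esub> (f ` A)"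
  by (simp add: sup_pres_def)

text \<open>This is the hom order of \<open>quotient_quantaloid\<close>, isolated so that a single
  hom-set can be studied as a lattice apart from composition.\<close>

definition quotient_order :: "'a gorder \<Rightarrow> ('a \<times> 'a) set \<Rightarrow> 'a set gorder"
  where "quotient_order L R =
    \<lparr>carrier = carrier L // R, eq = (=), le = (\<lambda>A B. \<exists>a \<in> A. \<exists>b \<in> B. a \<squnion>\<^bsub>L\<^esub> b \<in> B)\<rparr>"

lemma carrier_quotient_order [simp]: "carrier (quotient_order L R) = carrier L // R"
  by (simp add: quotient_order_def)

text \<open>This is what a quantaloid congruence amounts to on one hom-set.\<close>

locale sup_congruence = complete_lattice L for L :: "'a gorder" (structure) +
  fixes R :: "('a \<times> 'a) set"
  assumes equiv: "equiv (carrier L) R"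
    and sup_compat: "S \<subseteq> R \<Longrightarrow> (\<Squnion> (fst ` S), \<Squnion> (snd ` S)) \<in> R"
begin

abbreviation cls :: "'a \<Rightarrow> 'a set"
  where "cls x \<equiv> R `` {x}"

lemma related_carrier: "(x, y) \<in> R \<Longrightarrow> x \<in> carrier L \<and> y \<in> carrier L"
  using equiv by (auto simp: equiv_def refl_on_def)

lemma cls_carrier: "cls x \<subseteq> carrier L"
  using related_carrier by auto

lemma related_refl: "x \<in> carrier L \<Longrightarrow> (x, x) \<in> R"
  using equiv by (auto simp: equiv_def refl_on_def)

lemma related_sym: "(x, y) \<in> R \<Longrightarrow> (y, x) \<in> R"
  using equiv by (meson equivE symD)

lemma related_trans: "\<lbrakk>(x, y) \<in> R; (y, z) \<in> R\<rbrakk> \<Longrightarrow> (x, z) \<in> R"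
  using equiv by (meson equivE transD)

lemma cls_eq_iff: "\<lbrakk>x \<in> carrier L; y \<in> carrier L\<rbrakk> \<Longrightarrow> cls x = cls y \<longleftrightarrow> (x, y) \<in> R"
  using eq_equiv_class_iff[OF equiv] .

lemma join_compat:
  assumes "(x, x') \<in> R" "(y, y') \<in> R"
  shows "(x \<squnion> y, x' \<squnion> y') \<in> R"
  using sup_compat[of "{(x, x'), (y, y')}"] assms by (simp add: join_def)

text \<open>The rectangle \<open>cls x \<times> {x}\<close> lies in \<open>R\<close>; its first
  projection is the class and its second is \<open>{x}\<close>, whose join is \<open>x\<close>. So
  the join of a class belongs to the class and is its greatest element.\<close>

lemma sup_cls_related:
  assumes "x \<in> carrier L"
  shows "(x, \<Squnion> (cls x)) \<in> R"
proof -
  have *: "x \<in> cls x" using related_refl[OF assms] by simp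
  have "fst ` (cls x \<times> {x}) = cls x" "snd ` (cls x \<times> {x}) = {x}"
    using * by force+
  moreover have "cls x \<times> {x} \<subseteq> R" using related_sym by auto
  ultimately show ?thesis
    using sup_compat[of "cls x \<times> {x}"] assms related_sym by simp
qed

text \<open>Each class has a greatest element, which turns the order of the quotient into an
  inequality in \<open>L\<close>.\<close>

lemma cls_le_iff:
  assumes x: "x \<in> carrier L" and y: "y \<in> carrier L"
  shows "cls x \<sqsubseteq>\<^bsub>quotient_order L R\<^esub> cls y \<longleftrightarrow> x \<sqsubseteq> \<Squnion> (cls y)"
proof
  assume "cls x \<sqsubseteq>\<^bsub>quotient_order L R\<^esub> cls y"
  then obtain a b where ab: "(x, a) \<in> R" "(y, b) \<in> R" "(y, a \<squnion> b) \<in> R"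
    by (auto simp: quotient_order_def)
  \<comment> \<open>By compatibility with binary joins the witnesses \<open>a\<close> and
    \<open>b\<close> can be exchanged for \<open>x\<close> and \<open>y\<close>.\<close>
  then have "(x \<squnion> y, y) \<in> R"
    using join_compat related_sym related_trans by blast
  then have "x \<squnion> y \<in> cls y" using related_sym by blast
  then have "x \<squnion> y \<sqsubseteq> \<Squnion> (cls y)" by (intro sup_upper cls_carrier)
  moreover have "x \<sqsubseteq> x \<squnion> y" using x y by (rule join_left)
  ultimately show "x \<sqsubseteq> \<Squnion> (cls y)" using x y cls_carrier le_trans by (meson join_closed sup_closed)
next
  assume le: "x \<sqsubseteq> \<Squnion> (cls y)"
  have "x \<squnion> \<Squnion> (cls y) = \<Squnion> (cls y)"
    using le x cls_carrier[of y] by (meson join_le join_right le_antisym join_closed le_refl sup_closed)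
  then show "cls x \<sqsubseteq>\<^bsub>quotient_order L R\<^esub> cls y"
    unfolding quotient_order_def gorder.simps
    using related_refl[OF x] sup_cls_related[OF y]
    by (intro bexI[of _ x] bexI[of _ "\<Squnion> (cls y)"]) simp_all
qed

text \<open>Since \<open>\<Squnion> (cls y)\<close> absorbs \<open>x\<close>, compatibility puts its
  join with \<open>\<Squnion> (cls x)\<close> into \<open>cls y\<close>, where it cannot exceed the
  greatest element. Thus passing from \<open>x\<close> to \<open>\<Squnion> (cls x)\<close> is a
  closure operator, which gives transitivity and antisymmetry of the quotient order.\<close>

lemma sup_cls_cong_le:
  assumes "x \<in> carrier L" "y \<in> carrier L" "x \<sqsubseteq> \<Squnion> (cls y)"
  shows "\<Squnion> (cls x) \<sqsubseteq> \<Squnion> (cls y)"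
proof -
  have "(x \<squnion> \<Squnion> (cls y), \<Squnion> (cls x) \<squnion> \<Squnion> (cls y)) \<in> R"
    using assms cls_carrier by (intro join_compat sup_cls_related related_refl) auto
  moreover have "x \<squnion> \<Squnion> (cls y) = \<Squnion> (cls y)"
    using assms cls_carrier[of y] by (meson join_le join_right le_antisym join_closed le_refl sup_closed)
  ultimately have "\<Squnion> (cls x) \<squnion> \<Squnion> (cls y) \<in> cls y"
    using sup_cls_related[OF assms(2)] related_trans by auto
  then have "\<Squnion> (cls x) \<squnion> \<Squnion> (cls y) \<sqsubseteq> \<Squnion> (cls y)"
    by (intro sup_upper cls_carrier)
  moreover have "\<Squnion> (cls x) \<sqsubseteq> \<Squnion> (cls x) \<squnion> \<Squnion> (cls y)"
    by (intro join_left sup_closed cls_carrier)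
  ultimately show ?thesis
    by (meson le_trans join_closed sup_closed cls_carrier)
qed

lemma le_sup_cls: "x \<in> carrier L \<Longrightarrow> x \<sqsubseteq> \<Squnion> (cls x)"
  by (intro sup_upper cls_carrier) (simp add: related_refl)

text \<open>Through \<open>cls_le_iff\<close> classes are compared by their greatest elements, and
  two classes with the same greatest element coincide.\<close>

lemma partial_order_quotient: "partial_order (quotient_order L R)"
proof (rule partial_orderI)
  show "(.=\<^bsub>quotient_order L R\<^esub>) = (=)" by (simp add: quotient_order_def)
  fix A assume "A \<in> carrier (quotient_order L R)"
  then obtain a where a: "a \<in> carrier L" "A = cls a" by (auto elim: quotientE)
  then show "A \<sqsubseteq>\<^bsub>quotient_order L R\<^esub> A" by (simp add: cls_le_iff le_sup_cls)
  fix B assume "B \<in> carrier (quotient_order L R)"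
  then obtain b where b: "b \<in> carrier L" "B = cls b" by (auto elim: quotientE)
  {
    assume "A \<sqsubseteq>\<^bsub>quotient_order L R\<^esub> B" "B \<sqsubseteq>\<^bsub>quotient_order L R\<^esub> A"
    then have "\<Squnion> (cls a) = \<Squnion> (cls b)"
      using a b cls_carrier by (simp add: cls_le_iff le_antisym sup_cls_cong_le)
    then have "(a, b) \<in> R"
      using a b sup_cls_related related_sym related_trans by metis
    then show "A = B" using a b cls_eq_iff by simp
  }
  fix C assume "C \<in> carrier (quotient_order L R)"
  then obtain c where c: "c \<in> carrier L" "C = cls c" by (auto elim: quotientE)
  assume "A \<sqsubseteq>\<^bsub>quotient_order L R\<^esub> B" "B \<sqsubseteq>\<^bsub>quotient_order L R\<^esub> C"
  then have "a \<sqsubseteq> \<Squnion> (cls b)" "\<Squnion> (cls b) \<sqsubseteq> \<Squnion> (cls c)"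
    using a b c by (simp_all add: cls_le_iff sup_cls_cong_le)
  then have "a \<sqsubseteq> \<Squnion> (cls c)" using a cls_carrier by (meson le_trans sup_closed)
  then show "A \<sqsubseteq>\<^bsub>quotient_order L R\<^esub> C" using a c by (simp add: cls_le_iff)
qed

text \<open>By \<open>cls_le_iff\<close>, \<open>cls b\<close> bounds the classes of the members of
  \<open>T\<close> exactly when \<open>\<Squnion> (cls b)\<close> bounds \<open>T\<close>
  itself.\<close>

lemma least_cls_sup:
  assumes T: "T \<subseteq> carrier L"
  shows "least (quotient_order L R) (cls (\<Squnion> T)) (Upper (quotient_order L R) (cls ` T))"
proof (rule least_UpperI)
  fix A assume "A \<in> cls ` T"
  then obtain a where a: "a \<in> T" "A = cls a" by auto
  then have "a \<sqsubseteq> \<Squnion> T" using T by (intro sup_upper)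
  then have "a \<sqsubseteq> \<Squnion> (cls (\<Squnion> T))"
    using T a cls_carrier by (meson le_sup_cls le_trans sup_closed subsetD)
  then show "A \<sqsubseteq>\<^bsub>quotient_order L R\<^esub> cls (\<Squnion> T)"
    using a T by (simp add: cls_le_iff subsetD)
next
  fix B assume B: "B \<in> Upper (quotient_order L R) (cls ` T)"
  have T': "cls ` T \<subseteq> carrier (quotient_order L R)" using T by (auto intro: quotientI)
  obtain b where b: "b \<in> carrier L" "B = cls b"
    using B by (auto simp: Upper_def elim: quotientE)
  have "t \<sqsubseteq> \<Squnion> (cls b)" if "t \<in> T" for t
    using Upper_memD[OF B _ T', of "cls t"] that b T by (simp add: cls_le_iff subsetD)
  then have "\<Squnion> T \<sqsubseteq> \<Squnion> (cls b)" using T cls_carrier by (intro sup_least) auto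
  then show "cls (\<Squnion> T) \<sqsubseteq>\<^bsub>quotient_order L R\<^esub> B" using b T by (simp add: cls_le_iff)
qed (use T in \<open>auto intro: quotientI\<close>)

text \<open>Taking all representatives of all members of \<open>A\<close> avoids choosing one for
  each class.\<close>

lemma quotient_subset_image:
  assumes "A \<subseteq> carrier L // R"
  obtains T where "T \<subseteq> carrier L" "A = cls ` T"
proof
  show "{x \<in> carrier L. cls x \<in> A} \<subseteq> carrier L" by auto
  show "A = cls ` {x \<in> carrier L. cls x \<in> A}" using assms by (auto elim!: quotientE)
qed

lemma complete_lattice_quotient: "complete_lattice (quotient_order L R)"
proof (rule partial_order.complete_lattice_if_sups[OF partial_order_quotient])
  fix A assume "A \<subseteq> carrier (quotient_order L R)"
  then obtain T where "T \<subseteq> carrier L" "A = cls ` T"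
    by (auto elim: quotient_subset_image)
  then show "\<exists>x. least (quotient_order L R) x (Upper (quotient_order L R) A)"
    using least_cls_sup by auto
qed

lemma sup_cls_image: "T \<subseteq> carrier L \<Longrightarrow> \<Squnion>\<^bsub>quotient_order L R\<^esub> (cls ` T) = cls (\<Squnion> T)"
  by (rule partial_order.sup_eqI[OF partial_order_quotient least_cls_sup])

end

text \<open>Joins in both quotients are classes of joins of representatives, where \<open>h\<close>
  acts as \<open>f\<close>. Only the values of \<open>h\<close> on classes are prescribed, so
  \<open>h\<close> may be composition in a quotient as well as a direct image.\<close>

lemma sup_pres_quotient:
  assumes "sup_congruence X R" "sup_congruence Y R'"
    and f: "sup_pres X Y f" "f \<in> carrier X \<rightarrow> carrier Y"
    and h: "\<And>x. x \<in> carrier X \<Longrightarrow> h (R `` {x}) = R' `` {f x}"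
  shows "sup_pres (quotient_order X R) (quotient_order Y R') h"
proof -
  interpret X: sup_congruence X R by fact
  interpret Y: sup_congruence Y R' by fact
  have "h (\<Squnion>\<^bsub>quotient_order X R\<^esub> A) = \<Squnion>\<^bsub>quotient_order Y R'\<^esub> (h ` A)"
    if "A \<subseteq> carrier (quotient_order X R)" for A
  proof -
    obtain T where T: "T \<subseteq> carrier X" "A = X.cls ` T"
      using \<open>A \<subseteq> _\<close> by (auto elim: X.quotient_subset_image)
    have "h ` A = Y.cls ` (f ` T)" using T h by (auto simp: image_image subsetD intro!: image_cong)
    moreover have "f ` T \<subseteq> carrier Y" using T f(2) by auto
    ultimately show ?thesis
      using T by (simp add: X.sup_cls_image Y.sup_cls_image h sup_pres_sup[OF f(1)])
  qed
  then show ?thesis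
    by (simp add: sup_pres_def X.complete_lattice_quotient Y.complete_lattice_quotient)
qed

section \<open>Quotient quantaloids\<close>

lemma quotient_quantaloid_simps [simp]:
  "Ob (quotient_quantaloid Q E) = Ob Q"
  "Hom (quotient_quantaloid Q E) p q = quotient_order (Hom Q p q) (E p q)"
  "Ide (quotient_quantaloid Q E) p = E p p `` {Ide Q p}"
  by (simp_all add: quotient_quantaloid_def quotient_order_def)

context quantaloid_congruence
begin

lemma sup_congruence_hom: "\<lbrakk>p \<in> Ob Q; q \<in> Ob Q\<rbrakk> \<Longrightarrow> sup_congruence (Hom Q p q) (E p q)"
  by (intro sup_congruence.intro sup_congruence_axioms.intro hom_complete_lattice equiv sup_cong)

text \<open>By \<open>comp_cong\<close> all members of the double union in the definition of
  \<open>Comp\<close> are the same class.\<close>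

lemma comp_class:
  assumes "p \<in> Ob Q" "q \<in> Ob Q" "r \<in> Ob Q" "u \<in> Arrows Q p q" "v \<in> Arrows Q q r"
  shows "Comp (quotient_quantaloid Q E) p q r (E q r `` {v}) (E p q `` {u})
    = E p r `` {Comp Q p q r v u}"
proof -
  interpret pq: sup_congruence "Hom Q p q" "E p q" using assms by (intro sup_congruence_hom)
  interpret qr: sup_congruence "Hom Q q r" "E q r" using assms by (intro sup_congruence_hom)
  have "E p r `` {Comp Q p q r b a} = E p r `` {Comp Q p q r v u}"
    if "b \<in> E q r `` {v}" "a \<in> E p q `` {u}" for a b
    using equiv_class_eq[OF equiv comp_cong, of p r q u a v b] assms that by simp
  then have "(\<Union>b \<in> E q r `` {v}. \<Union>a \<in> E p q `` {u}. E p r `` {Comp Q p q r b a})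
      = (\<Union>b \<in> E q r `` {v}. \<Union>a \<in> E p q `` {u}. E p r `` {Comp Q p q r v u})"
    by simp
  \<comment> \<open>Both index sets are inhabited, so the constant unions collapse to that constant
    and not to the empty set.\<close>
  moreover have "v \<in> E q r `` {v}" "u \<in> E p q `` {u}"
    using assms pq.related_refl qr.related_refl by auto
  ultimately show ?thesis
    unfolding quotient_quantaloid_def by (simp, blast)
qed

lemma quotient_arrowE:
  assumes "A \<in> Arrows (quotient_quantaloid Q E) p q"
  obtains u where "u \<in> Arrows Q p q" "A = E p q `` {u}"
  using assms by (auto elim: quotientE)

text \<open>The category laws descend to classes by \<open>comp_class\<close>, and join preservation
  descends by \<open>sup_pres_quotient\<close>.\<close>

theorem quantaloid_quotient: "quantaloid (quotient_quantaloid Q E)"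
    (is "quantaloid ?Q")
proof (rule quantaloid.intro)
  show "Ide ?Q p \<in> Arrows ?Q p p" if "p \<in> Ob ?Q" for p
    using that by (auto intro: quotientI id_closed)
  show "complete_lattice (Hom ?Q p q)" if "p \<in> Ob ?Q" "q \<in> Ob ?Q" for p q
    using that by (simp add: sup_congruence.complete_lattice_quotient sup_congruence_hom)
next
  fix p q A assume O: "p \<in> Ob ?Q" "q \<in> Ob ?Q" and "A \<in> Arrows ?Q p q"
  then obtain u where u: "u \<in> Arrows Q p q" "A = E p q `` {u}" using quotient_arrowE by blast
  show "Comp ?Q p p q A (Ide ?Q p) = A" "Comp ?Q p q q (Ide ?Q q) A = A"
    using O u by (simp_all add: comp_class id_closed comp_id_right comp_id_left)
next
  fix p q r A assume O: "p \<in> Ob ?Q" "q \<in> Ob ?Q" "r \<in> Ob ?Q" and "A \<in> Arrows ?Q p q"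
  then obtain u where u: "u \<in> Arrows Q p q" "A = E p q `` {u}" using quotient_arrowE by blast
  show "sup_pres (Hom ?Q q r) (Hom ?Q p r) (\<lambda>B. Comp ?Q p q r B A)"
    unfolding quotient_quantaloid_simps
    by (rule sup_pres_quotient[OF _ _ comp_sup_left[where p = p and q = q and u = u]])
      (use O u in \<open>auto simp: comp_class sup_congruence_hom comp_closed\<close>)
next
  fix p q r B assume O: "p \<in> Ob ?Q" "q \<in> Ob ?Q" "r \<in> Ob ?Q" and "B \<in> Arrows ?Q q r"
  then obtain v where v: "v \<in> Arrows Q q r" "B = E q r `` {v}" using quotient_arrowE by blast
  show "sup_pres (Hom ?Q p q) (Hom ?Q p r) (\<lambda>A. Comp ?Q p q r B A)"
    unfolding quotient_quantaloid_simps
    by (rule sup_pres_quotient[OF _ _ comp_sup_right[where q = q and r = r and v = v]])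
      (use O v in \<open>auto simp: comp_class sup_congruence_hom comp_closed\<close>)
next
  fix p q r A B assume O: "p \<in> Ob ?Q" "q \<in> Ob ?Q" "r \<in> Ob ?Q"
    and "A \<in> Arrows ?Q p q" "B \<in> Arrows ?Q q r"
  then obtain u v where uv: "u \<in> Arrows Q p q" "A = E p q `` {u}"
    "v \<in> Arrows Q q r" "B = E q r `` {v}"
    by (blast elim: quotient_arrowE)
  show "Comp ?Q p q r B A \<in> Arrows ?Q p r"
    using O uv by (simp add: comp_class quotientI comp_closed)
  fix s C assume s: "s \<in> Ob ?Q" and "C \<in> Arrows ?Q r s"
  then obtain w where w: "w \<in> Arrows Q r s" "C = E r s `` {w}"
    by (blast elim: quotient_arrowE)
  show "Comp ?Q p r s C (Comp ?Q p q r B A) = Comp ?Q p q s (Comp ?Q q r s C B) A"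
    using O s uv w by (simp add: comp_class comp_closed comp_assoc)
qed

end

section \<open>Transport of congruences and isomorphisms along functors\<close>

lemma is_functor_closed:
  assumes "is_functor Q R F f"
  shows "p \<in> Ob Q \<Longrightarrow> F p \<in> Ob R"
    and "\<lbrakk>p \<in> Ob Q; q \<in> Ob Q; u \<in> Arrows Q p q\<rbrakk> \<Longrightarrow> f p q u \<in> Arrows R (F p) (F q)"
  using assms unfolding is_functor_def by blast+

lemma is_functor_id: "\<lbrakk>is_functor Q R F f; p \<in> Ob Q\<rbrakk> \<Longrightarrow> f p p (Ide Q p) = Ide R (F p)"
  by (simp add: is_functor_def)

lemma is_functor_comp:
  assumes "is_functor Q R F f" "p \<in> Ob Q" "q \<in> Ob Q" "r \<in> Ob Q"
    "u \<in> Arrows Q p q" "v \<in> Arrows Q q r"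
  shows "f p r (Comp Q p q r v u) = Comp R (F p) (F q) (F r) (f q r v) (f p q u)"
  using assms unfolding is_functor_def by blast

text \<open>The map \<open>f\<close> commutes with composition and joins, so each axiom for
  \<open>K\<close> is an axiom for \<open>E\<close> at the images. This will give the congruence on
  \<open>ChuCon Q\<close> from the one on \<open>Arr Q\<close>.\<close>

lemma congruence_pullback:
  assumes "quantaloid_congruence R E" "quantaloid_homomorphism Q R F f"
    and K: "\<And>p q. \<lbrakk>p \<in> Ob Q; q \<in> Ob Q\<rbrakk> \<Longrightarrow> K p q =
      {(u, u') \<in> Arrows Q p q \<times> Arrows Q p q. (f p q u, f p q u') \<in> E (F p) (F q)}"
  shows "quantaloid_congruence Q K"
proof -
  interpret R: quantaloid_congruence R E by fact
  interpret Q: quantaloid Q using assms(2) by (simp add: quantaloid_homomorphism_def)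
  have F: "is_functor Q R F f" using assms(2) by (simp add: quantaloid_homomorphism_def)
  note closed = is_functor_closed[OF F]
  show ?thesis
  proof
    fix p q assume O: "p \<in> Ob Q" "q \<in> Ob Q"
    interpret sup_congruence "Hom R (F p) (F q)" "E (F p) (F q)"
      using O closed by (intro R.sup_congruence_hom)
    interpret Qpq: complete_lattice "Hom Q p q"
      using O by (rule Q.hom_complete_lattice)
    show "equiv (Arrows Q p q) (K p q)"
    proof (intro equivI refl_onI symI transI)
      show "(u, u) \<in> K p q" if "u \<in> Arrows Q p q" for u
        using that O closed related_refl by (simp add: K)
      show "(u', u) \<in> K p q" if "(u, u') \<in> K p q" for u u'
        using that related_sym by (simp add: K O)
      show "(u, w) \<in> K p q" if "(u, v) \<in> K p q" "(v, w) \<in> K p q" for u v w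
        using that related_trans[of "f p q u" "f p q v"] by (simp add: K O)
    qed (auto simp: K O)
    fix S assume S: "S \<subseteq> K p q"
    have fS: "fst ` S \<subseteq> Arrows Q p q" "snd ` S \<subseteq> Arrows Q p q" using S by (auto simp: K O)
    have sp: "sup_pres (Hom Q p q) (Hom R (F p) (F q)) (f p q)"
      using assms(2) O by (simp add: quantaloid_homomorphism_def)
    \<comment> \<open>The family is pushed forward in both components, where
      \<open>R.sup_cong\<close> applies; preservation of joins then pulls the result back.\<close>
    have "map_prod (f p q) (f p q) ` S \<subseteq> E (F p) (F q)" using S by (auto simp: K O)
    from R.sup_cong[OF _ _ this] have
      "(f p q (\<Squnion>\<^bsub>Hom Q p q\<^esub> (fst ` S)), f p q (\<Squnion>\<^bsub>Hom Q p q\<^esub> (snd ` S))) \<in> E (F p) (F q)"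
      using O closed fS by (simp add: image_image sup_pres_sup[OF sp])
    then show "(\<Squnion>\<^bsub>Hom Q p q\<^esub> (fst ` S), \<Squnion>\<^bsub>Hom Q p q\<^esub> (snd ` S)) \<in> K p q"
      using fS by (simp add: K O)
  qed (auto simp: K Q.comp_closed is_functor_comp[OF F] closed R.comp_cong)
qed

text \<open>Direct image can serve as the arrow part because \<open>cls\<close> makes the image of a
  class a whole class, not just a subset of one.\<close>

lemma is_functor_quotient:
  assumes "quantaloid_congruence Q E" "quantaloid_congruence R E'"
    and F: "is_functor Q R F f"
    and cls: "\<And>p q u. \<lbrakk>p \<in> Ob Q; q \<in> Ob Q; u \<in> Arrows Q p q\<rbrakk>
      \<Longrightarrow> f p q ` (E p q `` {u}) = E' (F p) (F q) `` {f p q u}"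
  shows "is_functor (quotient_quantaloid Q E) (quotient_quantaloid R E') F (\<lambda>p q. (`) (f p q))"
proof -
  interpret Q: quantaloid_congruence Q E by fact
  interpret R: quantaloid_congruence R E' by fact
  note closed = is_functor_closed[OF F]
  show ?thesis
    unfolding is_functor_def
  proof (intro conjI ballI)
    show "F \<in> Ob (quotient_quantaloid Q E) \<rightarrow> Ob (quotient_quantaloid R E')"
      using closed by simp
  next
    fix p q assume "p \<in> Ob (quotient_quantaloid Q E)" "q \<in> Ob (quotient_quantaloid Q E)"
    then show "(`) (f p q) \<in> Arrows (quotient_quantaloid Q E) p q
        \<rightarrow> Arrows (quotient_quantaloid R E') (F p) (F q)"
      using closed by (auto elim!: quotientE simp: cls intro!: quotientI)
  next
    fix p assume "p \<in> Ob (quotient_quantaloid Q E)"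
    then show "f p p ` Ide (quotient_quantaloid Q E) p = Ide (quotient_quantaloid R E') (F p)"
      by (simp add: cls Q.id_closed is_functor_id[OF F])
  next
    fix p q r A B
    assume "p \<in> Ob (quotient_quantaloid Q E)" "q \<in> Ob (quotient_quantaloid Q E)"
      "r \<in> Ob (quotient_quantaloid Q E)"
    then have O: "p \<in> Ob Q" "q \<in> Ob Q" "r \<in> Ob Q" by simp_all
    assume "A \<in> Arrows (quotient_quantaloid Q E) p q" "B \<in> Arrows (quotient_quantaloid Q E) q r"
    then obtain u v where "u \<in> Arrows Q p q" "A = E p q `` {u}"
      "v \<in> Arrows Q q r" "B = E q r `` {v}"
      by (metis Q.quotient_arrowE)
    then show "f p r ` Comp (quotient_quantaloid Q E) p q r B A =
      Comp (quotient_quantaloid R E') (F p) (F q) (F r) (f q r ` B) (f p q ` A)"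
      using O by (simp add: cls Q.comp_class R.comp_class Q.comp_closed closed is_functor_comp[OF F])
  qed
qed

text \<open>Since \<open>f\<close> is bijective on hom-sets and both preserves and reflects the
  congruences, direct images under \<open>f\<close> and \<open>g\<close> map classes onto classes
  and are mutually inverse.\<close>

lemma isomorphic_quotients:
  assumes "quantaloid_congruence Q E" "quantaloid_congruence R E'"
    and hom: "quantaloid_homomorphism Q R F f"
    and G: "is_functor R Q G g"
    and inv: "inverse_functors Q R F f G g"
    and E: "\<And>p q u u'. \<lbrakk>p \<in> Ob Q; q \<in> Ob Q; u \<in> Arrows Q p q; u' \<in> Arrows Q p q\<rbrakk>
      \<Longrightarrow> (f p q u, f p q u') \<in> E' (F p) (F q) \<longleftrightarrow> (u, u') \<in> E p q"
  shows "isomorphic_quantaloids (quotient_quantaloid Q E) (quotient_quantaloid R E')"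
proof -
  interpret Q: quantaloid_congruence Q E by fact
  interpret R: quantaloid_congruence R E' by fact
  have F: "is_functor Q R F f" using hom by (simp add: quantaloid_homomorphism_def)
  note Fc = is_functor_closed[OF F] and Gc = is_functor_closed[OF G]
  have GF: "G (F p) = p" if "p \<in> Ob Q" for p
    using inv that by (simp add: inverse_functors_def)
  have FG: "F (G x) = x" if "x \<in> Ob R" for x
    using inv that by (simp add: inverse_functors_def)
  have gf: "g (F p) (F q) (f p q u) = u" if "p \<in> Ob Q" "q \<in> Ob Q" "u \<in> Arrows Q p q" for p q u
    using inv that by (simp add: inverse_functors_def)
  have fg: "f (G x) (G y) (g x y v) = v" if "x \<in> Ob R" "y \<in> Ob R" "v \<in> Arrows R x y" for x y v
    using inv that by (simp add: inverse_functors_def)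
  \<comment> \<open>The condition for \<open>g\<close> is the hypothesis \<open>E\<close> read at
    images under \<open>g\<close>, where \<open>f\<close> undoes \<open>g\<close>.\<close>
  have E': "(g x y v, g x y v') \<in> E (G x) (G y) \<longleftrightarrow> (v, v') \<in> E' x y"
    if "x \<in> Ob R" "y \<in> Ob R" "v \<in> Arrows R x y" "v' \<in> Arrows R x y" for x y v v'
    using E[of "G x" "G y" "g x y v" "g x y v'"] that by (simp add: Gc FG fg)
  have fcls: "f p q ` (E p q `` {u}) = E' (F p) (F q) `` {f p q u}"
    if O: "p \<in> Ob Q" "q \<in> Ob Q" and u: "u \<in> Arrows Q p q" for p q u
  proof -
    interpret pq: sup_congruence "Hom Q p q" "E p q" using O by (intro Q.sup_congruence_hom)
    interpret FF: sup_congruence "Hom R (F p) (F q)" "E' (F p) (F q)"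
      using O Fc by (intro R.sup_congruence_hom)
    show ?thesis
    proof (intro equalityI subsetI)
      fix v assume "v \<in> f p q ` (E p q `` {u})"
      then show "v \<in> E' (F p) (F q) `` {f p q u}"
        using pq.related_carrier E[OF O u] by auto
    next
      fix v assume v: "v \<in> E' (F p) (F q) `` {f p q u}"
      then have vc: "v \<in> Arrows R (F p) (F q)" using FF.related_carrier by auto
      \<comment> \<open>The preimage of \<open>v\<close> under \<open>f\<close> is supplied by the
        inverse functor.\<close>
      have "g (F p) (F q) v \<in> Arrows Q p q"
        using Gc(2)[OF Fc(1)[OF O(1)] Fc(1)[OF O(2)] vc] by (simp add: GF O)
      moreover have "f p q (g (F p) (F q) v) = v"
        using fg[OF Fc(1)[OF O(1)] Fc(1)[OF O(2)] vc] by (simp add: GF O)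
      ultimately show "v \<in> f p q ` (E p q `` {u})"
        using v E[OF O u, of "g (F p) (F q) v"]
        by (intro image_eqI[of _ _ "g (F p) (F q) v"]) simp_all
    qed
  qed
  have gcls: "g x y ` (E' x y `` {v}) = E (G x) (G y) `` {g x y v}"
    if O: "x \<in> Ob R" "y \<in> Ob R" and v: "v \<in> Arrows R x y" for x y v
  proof -
    interpret xy: sup_congruence "Hom R x y" "E' x y" using O by (intro R.sup_congruence_hom)
    \<comment> \<open>The claim for \<open>g\<close> follows from the one for \<open>f\<close>:
      write the class as an image under \<open>f\<close> and cancel.\<close>
    have "E' x y `` {v} = f (G x) (G y) ` (E (G x) (G y) `` {g x y v})"
      using fcls[of "G x" "G y" "g x y v"] O v by (simp add: Gc FG fg)
    moreover have "g x y ` f (G x) (G y) ` A = A" if "A \<subseteq> Arrows Q (G x) (G y)" for A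
    proof -
      have "g x y (f (G x) (G y) a) = a" if "a \<in> A" for a
        using gf[of "G x" "G y" a] O Gc(1) FG that \<open>A \<subseteq> _\<close> by auto
      then show ?thesis by (force simp: image_image)
    qed
    moreover have "E (G x) (G y) `` {g x y v} \<subseteq> Arrows Q (G x) (G y)"
      using O Gc by (intro sup_congruence.cls_carrier Q.sup_congruence_hom)
    ultimately show ?thesis by simp
  qed
  let ?Q = "quotient_quantaloid Q E" and ?R = "quotient_quantaloid R E'"
  let ?f = "\<lambda>p q. (`) (f p q)" and ?g = "\<lambda>x y. (`) (g x y)"
  have F': "is_functor ?Q ?R F ?f"
    by (rule is_functor_quotient[OF assms(1,2) F fcls])
  have G': "is_functor ?R ?Q G ?g"
    by (rule is_functor_quotient[OF assms(2,1) G gcls])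
  have "inverse_functors ?Q ?R F ?f G ?g"
    unfolding inverse_functors_def
  proof (intro conjI ballI)
    fix p q A assume "p \<in> Ob ?Q" "q \<in> Ob ?Q" "A \<in> Arrows ?Q p q"
    then obtain u where "p \<in> Ob Q" "q \<in> Ob Q" "u \<in> Arrows Q p q" "A = E p q `` {u}"
      by (metis Q.quotient_arrowE quotient_quantaloid_simps(1))
    then show "?g (F p) (F q) (?f p q A) = A"
      using gcls[of "F p" "F q" "f p q u"] by (simp only: fcls Fc gf GF)
  next
    fix x y B assume "x \<in> Ob ?R" "y \<in> Ob ?R" "B \<in> Arrows ?R x y"
    then obtain v where "x \<in> Ob R" "y \<in> Ob R" "v \<in> Arrows R x y" "B = E' x y `` {v}"
      by (metis R.quotient_arrowE quotient_quantaloid_simps(1))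
    then show "?f (G x) (G y) (?g x y B) = B"
      using fcls[of "G x" "G y" "g x y v"] by (simp only: gcls Gc fg FG)
  qed (simp_all add: GF FG)
  moreover have "quantaloid_homomorphism ?Q ?R F ?f"
    unfolding quantaloid_homomorphism_def
  proof (intro conjI ballI)
    fix p q assume "p \<in> Ob ?Q" "q \<in> Ob ?Q"
    then have O: "p \<in> Ob Q" "q \<in> Ob Q" by simp_all
    then have "sup_pres (Hom Q p q) (Hom R (F p) (F q)) (f p q)"
      using hom by (simp add: quantaloid_homomorphism_def)
    then show "sup_pres (Hom ?Q p q) (Hom ?R (F p) (F q)) (?f p q)"
      unfolding quotient_quantaloid_simps
      by (rule sup_pres_quotient[rotated 2])
        (use O in \<open>auto simp: Q.sup_congruence_hom R.sup_congruence_hom Fc fcls\<close>)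
  qed (use F' Q.quantaloid_quotient R.quantaloid_quotient in auto)
  ultimately show ?thesis
    unfolding isomorphic_quantaloids_def category_isomorphism_def
    using F' G' Q.quantaloid_quotient R.quantaloid_quotient by blast
qed

section \<open>Quantaloids of pairs of arrows\<close>

lemma Ob_arrow_pairs [simp]:
  "(p, q, u) \<in> Ob (arrow_pairs Q P) \<longleftrightarrow> p \<in> Ob Q \<and> q \<in> Ob Q \<and> u \<in> Arrows Q p q"
  by (simp add: arrow_pairs_def)

lemma Arrows_arrow_pairs [simp]:
  "(s, t) \<in> Arrows (arrow_pairs Q P) (p, q, u) (p', q', v) \<longleftrightarrow>
    s \<in> Arrows Q p p' \<and> t \<in> Arrows Q q q' \<and> P (p, q, u) (p', q', v) (s, t)"
  by (simp add: arrow_pairs_def)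

lemma le_arrow_pairs [simp]:
  "(s, t) \<sqsubseteq>\<^bsub>Hom (arrow_pairs Q P) (p, q, u) (p', q', v)\<^esub> (s', t') \<longleftrightarrow>
    s \<sqsubseteq>\<^bsub>Hom Q p p'\<^esub> s' \<and> t \<sqsubseteq>\<^bsub>Hom Q q q'\<^esub> t'"
  by (simp add: arrow_pairs_def)

lemma eq_arrow_pairs: "(.=\<^bsub>Hom (arrow_pairs Q P) a b\<^esub>) = (=)"
  by (simp add: arrow_pairs_def split: prod.split)

lemma Comp_arrow_pairs [simp]:
  "Comp (arrow_pairs Q P) (p, q, u) (p', q', v) (p'', q'', w) (s', t') (s, t)
    = (Comp Q p p' p'' s' s, Comp Q q q' q'' t' t)"
  by (simp add: arrow_pairs_def)

lemma Ide_arrow_pairs [simp]: "Ide (arrow_pairs Q P) (p, q, u) = (Ide Q p, Ide Q q)"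
  by (simp add: arrow_pairs_def)

text \<open>These closure properties make the pairs satisfying \<open>P\<close> a quantaloid with
  componentwise structure. They are abstracted so that commuting squares and Chu connections share
  one construction.\<close>

locale arrow_condition = quantaloid Q for Q :: "('o, 'a) quantaloid_data" +
  fixes P :: "('o, 'a) arrow \<Rightarrow> ('o, 'a) arrow \<Rightarrow> 'a \<times> 'a \<Rightarrow> bool"
  assumes P_id: "\<lbrakk>p \<in> Ob Q; q \<in> Ob Q; u \<in> Arrows Q p q\<rbrakk>
      \<Longrightarrow> P (p, q, u) (p, q, u) (Ide Q p, Ide Q q)"
    and P_comp: "\<lbrakk>p \<in> Ob Q; q \<in> Ob Q; p' \<in> Ob Q; q' \<in> Ob Q; p'' \<in> Ob Q; q'' \<in> Ob Q;
        u \<in> Arrows Q p q; v \<in> Arrows Q p' q'; w \<in> Arrows Q p'' q'';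
        s \<in> Arrows Q p p'; t \<in> Arrows Q q q'; s' \<in> Arrows Q p' p''; t' \<in> Arrows Q q' q'';
        P (p, q, u) (p', q', v) (s, t); P (p', q', v) (p'', q'', w) (s', t')\<rbrakk>
      \<Longrightarrow> P (p, q, u) (p'', q'', w) (Comp Q p p' p'' s' s, Comp Q q q' q'' t' t)"
    and P_sup: "\<lbrakk>p \<in> Ob Q; q \<in> Ob Q; p' \<in> Ob Q; q' \<in> Ob Q;
        u \<in> Arrows Q p q; v \<in> Arrows Q p' q'; S \<subseteq> Arrows Q p p' \<times> Arrows Q q q';
        \<And>x. x \<in> S \<Longrightarrow> P (p, q, u) (p', q', v) x\<rbrakk>
      \<Longrightarrow> P (p, q, u) (p', q', v) (\<Squnion>\<^bsub>Hom Q p p'\<^esub> (fst ` S), \<Squnion>\<^bsub>Hom Q q q'\<^esub> (snd ` S))"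
begin

context
  fixes p q u p' q' v
  assumes a: "(p, q, u) \<in> Ob (arrow_pairs Q P)" and b: "(p', q', v) \<in> Ob (arrow_pairs Q P)"
begin

abbreviation "L \<equiv> Hom (arrow_pairs Q P) (p, q, u) (p', q', v)"

interpretation X: complete_lattice "Hom Q p p'"
  using a b by (intro hom_complete_lattice) simp_all

interpretation Y: complete_lattice "Hom Q q q'"
  using a b by (intro hom_complete_lattice) simp_all

lemma partial_order_pairs: "partial_order L"
proof (rule partial_orderI[OF eq_arrow_pairs])
  fix x y z assume "x \<in> carrier L" "y \<in> carrier L" "z \<in> carrier L" "x \<sqsubseteq>\<^bsub>L\<^esub> y" "y \<sqsubseteq>\<^bsub>L\<^esub> z"
  then show "x \<sqsubseteq>\<^bsub>L\<^esub> z"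
    by (cases x; cases y; cases z) (auto intro: X.le_trans Y.le_trans)
qed auto

lemma carrier_fst_snd:
  assumes "S \<subseteq> carrier L"
  shows "fst ` S \<subseteq> Arrows Q p p'" "snd ` S \<subseteq> Arrows Q q q'"
  using assms by auto

text \<open>The property \<open>P_sup\<close> puts the componentwise join among the arrows; being
  least is then inherited from the product order.\<close>

lemma least_pairs:
  assumes S: "S \<subseteq> carrier L"
  shows "least L (\<Squnion>\<^bsub>Hom Q p p'\<^esub> (fst ` S), \<Squnion>\<^bsub>Hom Q q q'\<^esub> (snd ` S)) (Upper L S)"
proof (rule least_UpperI)
  fix x assume "x \<in> S"
  then show "x \<sqsubseteq>\<^bsub>L\<^esub> (\<Squnion>\<^bsub>Hom Q p p'\<^esub> (fst ` S), \<Squnion>\<^bsub>Hom Q q q'\<^esub> (snd ` S))"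
    using carrier_fst_snd[OF S]
    by (cases x) (auto intro!: X.sup_upper Y.sup_upper intro: rev_image_eqI)
next
  fix y assume y: "y \<in> Upper L S"
  obtain s t where st: "y = (s, t)" by (cases y)
  have carr: "s \<in> Arrows Q p p'" "t \<in> Arrows Q q q'"
    using y by (auto simp: Upper_def st)
  have "fst x \<sqsubseteq>\<^bsub>Hom Q p p'\<^esub> s" "snd x \<sqsubseteq>\<^bsub>Hom Q q q'\<^esub> t" if "x \<in> S" for x
    using Upper_memD[OF y that S] by (cases x; simp add: st)+
  then show "(\<Squnion>\<^bsub>Hom Q p p'\<^esub> (fst ` S), \<Squnion>\<^bsub>Hom Q q q'\<^esub> (snd ` S)) \<sqsubseteq>\<^bsub>L\<^esub> y"
    using carrier_fst_snd[OF S] carr by (auto simp: st intro!: X.sup_least Y.sup_least)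
next
  have "S \<subseteq> Arrows Q p p' \<times> Arrows Q q q'" using S by auto
  moreover have "P (p, q, u) (p', q', v) x" if "x \<in> S" for x
    using subsetD[OF S that] by (cases x) simp
  ultimately show "(\<Squnion>\<^bsub>Hom Q p p'\<^esub> (fst ` S), \<Squnion>\<^bsub>Hom Q q q'\<^esub> (snd ` S)) \<in> carrier L"
    using carrier_fst_snd[OF S] a b by (simp add: P_sup)
qed (rule S)

lemma complete_lattice_pairs: "complete_lattice L"
  using least_pairs by (intro partial_order.complete_lattice_if_sups[OF partial_order_pairs]) blast

lemma sup_pairs:
  "S \<subseteq> carrier L \<Longrightarrow> \<Squnion>\<^bsub>L\<^esub> S = (\<Squnion>\<^bsub>Hom Q p p'\<^esub> (fst ` S), \<Squnion>\<^bsub>Hom Q q q'\<^esub> (snd ` S))"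
  by (rule partial_order.sup_eqI[OF partial_order_pairs least_pairs])

end

lemma comp_closed_pairs:
  assumes "a \<in> Ob (arrow_pairs Q P)" "b \<in> Ob (arrow_pairs Q P)" "c \<in> Ob (arrow_pairs Q P)"
    and "x \<in> Arrows (arrow_pairs Q P) a b" "y \<in> Arrows (arrow_pairs Q P) b c"
  shows "Comp (arrow_pairs Q P) a b c y x \<in> Arrows (arrow_pairs Q P) a c"
proof -
  obtain p q u p' q' v p'' q'' w s t s' t'
    where "a = (p, q, u)" "b = (p', q', v)" "c = (p'', q'', w)" "x = (s, t)" "y = (s', t')"
    by (cases a; cases b; cases c; cases x; cases y)
  then show ?thesis
    using assms P_comp[of p q p' q' p'' q'' u v w s t s' t']
    by (simp add: comp_closed[of p p' p''] comp_closed[of q q' q''])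
qed

lemma comp_sup_left_pairs:
  assumes O: "a \<in> Ob (arrow_pairs Q P)" "b \<in> Ob (arrow_pairs Q P)" "c \<in> Ob (arrow_pairs Q P)"
    and x: "x \<in> Arrows (arrow_pairs Q P) a b"
  shows "sup_pres (Hom (arrow_pairs Q P) b c) (Hom (arrow_pairs Q P) a c)
    (\<lambda>y. Comp (arrow_pairs Q P) a b c y x)"
proof -
  obtain p q u p' q' v p'' q'' w s t
    where abc: "a = (p, q, u)" "b = (p', q', v)" "c = (p'', q'', w)" and st: "x = (s, t)"
    by (cases a; cases b; cases c; cases x)
  note O' = O[unfolded abc]
  have "sup_pres (Hom Q p' p'') (Hom Q p p'') (\<lambda>s'. Comp Q p p' p'' s' s)"
    "sup_pres (Hom Q q' q'') (Hom Q q q'') (\<lambda>t'. Comp Q q q' q'' t' t)"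
    using O x by (simp_all add: comp_sup_left abc st)
  note sp = this[THEN sup_pres_sup]
  let ?f = "\<lambda>y. Comp (arrow_pairs Q P) a b c y x"
  \<comment> \<open>With projections in place of pattern matching, each projection of the image of
    \<open>S\<close> is an image of a projection of \<open>S\<close>.\<close>
  have f: "?f y = (Comp Q p p' p'' (fst y) s, Comp Q q q' q'' (snd y) t)" for y
    by (cases y) (simp add: abc st)
  show ?thesis
    unfolding sup_pres_def
  proof (intro conjI allI impI)
    fix S assume S: "S \<subseteq> Arrows (arrow_pairs Q P) b c"
    note S' = S[unfolded abc]
    have fS: "?f ` S \<subseteq> Arrows (arrow_pairs Q P) (p, q, u) (p'', q'', w)"
      using S comp_closed_pairs[OF O x] by (auto simp: abc)
    show "?f (\<Squnion>\<^bsub>Hom (arrow_pairs Q P) b c\<^esub> S) = \<Squnion>\<^bsub>Hom (arrow_pairs Q P) a c\<^esub> (?f ` S)"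
      using sup_pairs[OF O'(1,3) fS] sup_pairs[OF O'(2,3) S']
        sp(1)[OF carrier_fst_snd(1)[OF O'(2,3) S']] sp(2)[OF carrier_fst_snd(2)[OF O'(2,3) S']]
      unfolding f by (simp add: image_image abc)
  qed (use O' complete_lattice_pairs in \<open>simp_all only: abc\<close>)
qed

lemma comp_sup_right_pairs:
  assumes O: "a \<in> Ob (arrow_pairs Q P)" "b \<in> Ob (arrow_pairs Q P)" "c \<in> Ob (arrow_pairs Q P)"
    and y: "y \<in> Arrows (arrow_pairs Q P) b c"
  shows "sup_pres (Hom (arrow_pairs Q P) a b) (Hom (arrow_pairs Q P) a c)
    (\<lambda>x. Comp (arrow_pairs Q P) a b c y x)"
proof -
  obtain p q u p' q' v p'' q'' w s t
    where abc: "a = (p, q, u)" "b = (p', q', v)" "c = (p'', q'', w)" and st: "y = (s, t)"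
    by (cases a; cases b; cases c; cases y)
  note O' = O[unfolded abc]
  have "sup_pres (Hom Q p p') (Hom Q p p'') (\<lambda>s'. Comp Q p p' p'' s s')"
    "sup_pres (Hom Q q q') (Hom Q q q'') (\<lambda>t'. Comp Q q q' q'' t t')"
    using O y by (simp_all add: comp_sup_right abc st)
  note sp = this[THEN sup_pres_sup]
  let ?f = "\<lambda>x. Comp (arrow_pairs Q P) a b c y x"
  have f: "?f x = (Comp Q p p' p'' s (fst x), Comp Q q q' q'' t (snd x))" for x
    by (cases x) (simp add: abc st)
  show ?thesis
    unfolding sup_pres_def
  proof (intro conjI allI impI)
    fix S assume S: "S \<subseteq> Arrows (arrow_pairs Q P) a b"
    note S' = S[unfolded abc]
    have fS: "?f ` S \<subseteq> Arrows (arrow_pairs Q P) (p, q, u) (p'', q'', w)"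
      using S comp_closed_pairs[OF O _ y] by (auto simp: abc)
    show "?f (\<Squnion>\<^bsub>Hom (arrow_pairs Q P) a b\<^esub> S) = \<Squnion>\<^bsub>Hom (arrow_pairs Q P) a c\<^esub> (?f ` S)"
      using sup_pairs[OF O'(1,3) fS] sup_pairs[OF O'(1,2) S']
        sp(1)[OF carrier_fst_snd(1)[OF O'(1,2) S']] sp(2)[OF carrier_fst_snd(2)[OF O'(1,2) S']]
      unfolding f by (simp add: image_image abc)
  qed (use O' complete_lattice_pairs in \<open>simp_all only: abc\<close>)
qed

theorem quantaloid_arrow_pairs: "quantaloid (arrow_pairs Q P)" (is "quantaloid ?A")
proof (rule quantaloid.intro)
  show "Ide ?A a \<in> Arrows ?A a a" if "a \<in> Ob ?A" for a
    using that by (cases a) (simp add: id_closed P_id)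
  show "complete_lattice (Hom ?A a b)" if "a \<in> Ob ?A" "b \<in> Ob ?A" for a b
    using that complete_lattice_pairs by (metis prod.exhaust)
  show "Comp ?A a a b x (Ide ?A a) = x" "Comp ?A a b b (Ide ?A b) x = x"
    if "a \<in> Ob ?A" "b \<in> Ob ?A" "x \<in> Arrows ?A a b" for a b x
    using that by (cases a; cases b; cases x; simp add: comp_id_right comp_id_left)+
  show "Comp ?A a c e z (Comp ?A a b c y x) = Comp ?A a b e (Comp ?A b c e z y) x"
    if "a \<in> Ob ?A" "b \<in> Ob ?A" "c \<in> Ob ?A" "e \<in> Ob ?A"
      "x \<in> Arrows ?A a b" "y \<in> Arrows ?A b c" "z \<in> Arrows ?A c e" for a b c e x y z
    using that
    by (cases a; cases b; cases c; cases e; cases x; cases y; cases z) (simp add: comp_assoc)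
qed (rule comp_closed_pairs comp_sup_left_pairs comp_sup_right_pairs; assumption)+

end

text \<open>Joins are componentwise on both sides, so exchanging the coordinates respects them once
  it maps arrows to arrows.\<close>

lemma sup_pres_swap:
  assumes "arrow_condition Q P" "arrow_condition Q P'"
    and O: "(p, q, u) \<in> Ob (arrow_pairs Q P)" "(p', q', v) \<in> Ob (arrow_pairs Q P)"
      "(q, p, x) \<in> Ob (arrow_pairs Q P')" "(q', p', y) \<in> Ob (arrow_pairs Q P')"
    and swap: "prod.swap \<in> Arrows (arrow_pairs Q P) (p, q, u) (p', q', v)
      \<rightarrow> Arrows (arrow_pairs Q P') (q, p, x) (q', p', y)"
  shows "sup_pres (Hom (arrow_pairs Q P) (p, q, u) (p', q', v))
    (Hom (arrow_pairs Q P') (q, p, x) (q', p', y)) prod.swap"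
proof -
  interpret P: arrow_condition Q P by fact
  interpret P': arrow_condition Q P' by fact
  have "prod.swap ` S \<subseteq> Arrows (arrow_pairs Q P') (q, p, x) (q', p', y)"
    if "S \<subseteq> Arrows (arrow_pairs Q P) (p, q, u) (p', q', v)" for S
    using swap that by blast
  then show ?thesis
    unfolding sup_pres_def
    by (simp add: P.complete_lattice_pairs[OF O(1,2)] P'.complete_lattice_pairs[OF O(3,4)]
      P.sup_pairs[OF O(1,2)] P'.sup_pairs[OF O(3,4)] image_image)
qed

section \<open>Commutative squares\<close>

text \<open>It expands on input to the condition in \<open>Arr\<close>, so facts of
  \<open>arrow_condition\<close> can be folded with \<open>Arr_def\<close>.\<close>

abbreviation (input) commutes ::
  "('o, 'a) quantaloid_data \<Rightarrow> ('o, 'a) arrow \<Rightarrow> ('o, 'a) arrow \<Rightarrow> 'a \<times> 'a \<Rightarrow> bool"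
  where "commutes Q \<equiv> \<lambda>(p, q, u) (p', q', v) (s, t). Comp Q p p' q' v s = Comp Q p q q' t u"

context quantaloid
begin

lemma comp_sup_right_image:
  assumes "p \<in> Ob Q" "q \<in> Ob Q" "r \<in> Ob Q" "v \<in> Arrows Q q r" "S \<subseteq> Arrows Q p q"
  shows "Comp Q p q r v (\<Squnion>\<^bsub>Hom Q p q\<^esub> S) = \<Squnion>\<^bsub>Hom Q p r\<^esub> (Comp Q p q r v ` S)"
  using sup_pres_sup[OF comp_sup_right] assms by blast

lemma comp_sup_left_image:
  assumes "p \<in> Ob Q" "q \<in> Ob Q" "r \<in> Ob Q" "u \<in> Arrows Q p q" "S \<subseteq> Arrows Q q r"
  shows "Comp Q p q r (\<Squnion>\<^bsub>Hom Q q r\<^esub> S) u = \<Squnion>\<^bsub>Hom Q p r\<^esub> ((\<lambda>v. Comp Q p q r v u) ` S)"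
  using sup_pres_sup[OF comp_sup_left] assms by blast

text \<open>Composites are handled by pasting squares, joins by the distributivity of composition
  over joins.\<close>

lemma arrow_condition_commutes: "arrow_condition Q (commutes Q)"
proof (unfold_locales, unfold split)
  fix p q p' q' p'' q'' u v w s t s' t'
  assume O: "p \<in> Ob Q" "q \<in> Ob Q" "p' \<in> Ob Q" "q' \<in> Ob Q" "p'' \<in> Ob Q" "q'' \<in> Ob Q"
    and A: "u \<in> Arrows Q p q" "v \<in> Arrows Q p' q'" "w \<in> Arrows Q p'' q''"
      "s \<in> Arrows Q p p'" "t \<in> Arrows Q q q'" "s' \<in> Arrows Q p' p''" "t' \<in> Arrows Q q' q''"
    and vs: "Comp Q p p' q' v s = Comp Q p q q' t u"
    and ws: "Comp Q p' p'' q'' w s' = Comp Q p' q' q'' t' v"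
  have "Comp Q p p'' q'' w (Comp Q p p' p'' s' s) = Comp Q p p' q'' (Comp Q p' p'' q'' w s') s"
    using O A by (intro comp_assoc)
  also have "\<dots> = Comp Q p q' q'' t' (Comp Q p p' q' v s)"
    unfolding ws using O A by (intro comp_assoc[symmetric])
  also have "\<dots> = Comp Q p q q'' (Comp Q q q' q'' t' t) u"
    unfolding vs using O A by (intro comp_assoc)
  finally show "Comp Q p p'' q'' w (Comp Q p p' p'' s' s) = Comp Q p q q'' (Comp Q q q' q'' t' t) u" .
next
  fix p q p' q' u v S
  assume O: "p \<in> Ob Q" "q \<in> Ob Q" "p' \<in> Ob Q" "q' \<in> Ob Q"
    and A: "u \<in> Arrows Q p q" "v \<in> Arrows Q p' q'" and S: "S \<subseteq> Arrows Q p p' \<times> Arrows Q q q'"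
    and P: "\<And>x. x \<in> S \<Longrightarrow> case x of (s, t) \<Rightarrow> Comp Q p p' q' v s = Comp Q p q q' t u"
  have "fst ` S \<subseteq> Arrows Q p p'" "snd ` S \<subseteq> Arrows Q q q'" using S by auto
  \<comment> \<open>Commutativity of each square makes the two sets of diagonals equal, hence also
    their joins.\<close>
  moreover have "Comp Q p p' q' v ` fst ` S = (\<lambda>t. Comp Q p q q' t u) ` snd ` S"
    unfolding image_image by (rule image_cong) (use P in auto)
  ultimately show "Comp Q p p' q' v (\<Squnion>\<^bsub>Hom Q p p'\<^esub> (fst ` S)) =
      Comp Q p q q' (\<Squnion>\<^bsub>Hom Q q q'\<^esub> (snd ` S)) u"
    using O A by (simp add: comp_sup_right_image comp_sup_left_image)
qed (simp add: comp_id_left comp_id_right)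

text \<open>Of the three equations in \<open>Arr_cong\<close>, the outer two are the commutativity
  of the squares; equality of the diagonals remains.\<close>

lemma Arr_cong_iff:
  "(x, x') \<in> Arr_cong Q (p, q, u) (p', q', v) \<longleftrightarrow>
    x \<in> Arrows (Arr Q) (p, q, u) (p', q', v) \<and> x' \<in> Arrows (Arr Q) (p, q, u) (p', q', v) \<and>
    Comp Q p p' q' v (fst x) = Comp Q p p' q' v (fst x')"
  by (cases x; cases x') (auto simp: Arr_cong_def Arr_def)

text \<open>A class consists of the squares with a given diagonal, and the diagonal of a join or of
  a composite depends only on the diagonals involved.\<close>

lemma congruence_Arr: "quantaloid_congruence (Arr Q) (Arr_cong Q)"
proof -
  interpret A: arrow_condition Q "commutes Q" by (rule arrow_condition_commutes)
  interpret Arr: quantaloid "Arr Q" unfolding Arr_def by (rule A.quantaloid_arrow_pairs)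
  show ?thesis
  proof
    fix a b assume O: "a \<in> Ob (Arr Q)" "b \<in> Ob (Arr Q)"
    obtain p q u p' q' v where ab: "a = (p, q, u)" "b = (p', q', v)" by (cases a; cases b)
    show "equiv (Arrows (Arr Q) a b) (Arr_cong Q a b)"
      unfolding ab by (intro equivI refl_onI symI transI) (auto simp: Arr_cong_iff)
    fix S assume S: "S \<subseteq> Arr_cong Q a b"
    have fS: "fst ` S \<subseteq> Arrows (Arr Q) (p, q, u) (p', q', v)"
      "snd ` S \<subseteq> Arrows (Arr Q) (p, q, u) (p', q', v)"
      using S by (auto simp: ab Arr_cong_iff)
    note O' = O[unfolded ab]
    interpret complete_lattice "Hom (Arr Q) (p, q, u) (p', q', v)"
      using O' by (rule Arr.hom_complete_lattice)
    note sup = A.sup_pairs[folded Arr_def, OF O']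
    note carr = A.carrier_fst_snd(1)[folded Arr_def, OF O']
    have "Comp Q p p' q' v ` fst ` fst ` S = Comp Q p p' q' v ` fst ` snd ` S"
      unfolding image_image by (rule image_cong) (use S in \<open>auto simp: ab Arr_cong_iff\<close>)
    then have "Comp Q p p' q' v (fst (\<Squnion>\<^bsub>Hom (Arr Q) a b\<^esub> (fst ` S))) =
        Comp Q p p' q' v (fst (\<Squnion>\<^bsub>Hom (Arr Q) a b\<^esub> (snd ` S)))"
      using O' carr[OF fS(1)] carr[OF fS(2)] unfolding ab sup[OF fS(1)] sup[OF fS(2)] fst_conv
      by (simp add: Arr_def comp_sup_right_image)
    then show "(\<Squnion>\<^bsub>Hom (Arr Q) a b\<^esub> (fst ` S), \<Squnion>\<^bsub>Hom (Arr Q) a b\<^esub> (snd ` S)) \<in> Arr_cong Q a b"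
      using fS by (simp add: ab Arr_cong_iff)
  next
    fix a b c x x' y y'
    assume O: "a \<in> Ob (Arr Q)" "b \<in> Ob (Arr Q)" "c \<in> Ob (Arr Q)"
      and x: "(x, x') \<in> Arr_cong Q a b" and y: "(y, y') \<in> Arr_cong Q b c"
    obtain p q u p' q' v p'' q'' w
      where abc: "a = (p, q, u)" "b = (p', q', v)" "c = (p'', q'', w)"
      by (cases a; cases b; cases c)
    obtain s t s' t' m n m' n'
      where xy: "x = (s, t)" "x' = (s', t')" "y = (m, n)" "y' = (m', n')"
      by (cases x; cases x'; cases y; cases y')
    have O': "p \<in> Ob Q" "p' \<in> Ob Q" "q' \<in> Ob Q" "p'' \<in> Ob Q" "q'' \<in> Ob Q"
        "v \<in> Arrows Q p' q'" "w \<in> Arrows Q p'' q''"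
      using O by (simp_all add: abc Arr_def)
    have arrows: "x \<in> Arrows (Arr Q) a b" "x' \<in> Arrows (Arr Q) a b"
      "y \<in> Arrows (Arr Q) b c" "y' \<in> Arrows (Arr Q) b c"
      using x y by (simp_all add: abc Arr_cong_iff)
    have st: "s \<in> Arrows Q p p'" "s' \<in> Arrows Q p p'" "m \<in> Arrows Q p' p''" "m' \<in> Arrows Q p' p''"
      "n \<in> Arrows Q q' q''" "n' \<in> Arrows Q q' q''"
      using arrows by (simp_all add: abc xy Arr_def)
    \<comment> \<open>Both \<open>y\<close> and \<open>y'\<close> have diagonal \<open>n\<close>
      after \<open>v\<close>, so each composite has as its diagonal \<open>n\<close> after the
      diagonal of its first factor.\<close>
    have wm: "Comp Q p' p'' q'' w m = Comp Q p' q' q'' n v"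
      "Comp Q p' p'' q'' w m' = Comp Q p' q' q'' n v"
      using x y by (auto simp: abc xy Arr_cong_iff Arr_def)
    have vs: "Comp Q p p' q' v s = Comp Q p p' q' v s'"
      using x by (simp add: abc xy Arr_cong_iff)
    have "Comp Q p p'' q'' w (Comp Q p p' p'' m s) = Comp Q p q' q'' n (Comp Q p p' q' v s)"
      "Comp Q p p'' q'' w (Comp Q p p' p'' m' s') = Comp Q p q' q'' n (Comp Q p p' q' v s')"
      using O' st by (simp_all add: comp_assoc wm)
    then have "Comp Q p p'' q'' w (Comp Q p p' p'' m s) = Comp Q p p'' q'' w (Comp Q p p' p'' m' s')"
      by (simp add: vs)
    moreover have "Comp (Arr Q) a b c y x \<in> Arrows (Arr Q) a c"
      "Comp (Arr Q) a b c y' x' \<in> Arrows (Arr Q) a c"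
      using O arrows by (simp_all add: Arr.comp_closed)
    ultimately show "(Comp (Arr Q) a b c y x, Comp (Arr Q) a b c y' x') \<in> Arr_cong Q a c"
      by (simp add: abc xy Arr_cong_iff Arr_def)
  qed
qed

end

section \<open>Girard quantaloids\<close>

context quantaloid
begin

text \<open>This is the Yoneda principle for an ordered set, suited to residuals because these are
  known only through what lies below them.\<close>

lemma le_antisym_by_le:
  assumes "p \<in> Ob Q" "q \<in> Ob Q" "x \<in> Arrows Q p q" "y \<in> Arrows Q p q"
    and "\<And>z. z \<in> Arrows Q p q \<Longrightarrow> z \<sqsubseteq>\<^bsub>Hom Q p q\<^esub> x \<longleftrightarrow> z \<sqsubseteq>\<^bsub>Hom Q p q\<^esub> y"
  shows "x = y"
proof -
  interpret complete_lattice "Hom Q p q" using assms by (intro hom_complete_lattice)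
  show ?thesis using assms(3-5) by (meson le_antisym le_refl)
qed

text \<open>By adjointness, \<open>z\<close> lies below either side iff \<open>z\<close> after
  \<open>v\<close> after \<open>u\<close> lies below \<open>w\<close>. The argument for
  \<open>rres_comp\<close> is the mirror image.\<close>

lemma lres_comp:
  assumes "p \<in> Ob Q" "q \<in> Ob Q" "r \<in> Ob Q" "s \<in> Ob Q"
    "u \<in> Arrows Q p q" "v \<in> Arrows Q q r" "w \<in> Arrows Q p s"
  shows "lres Q q r s (lres Q p q s w u) v = lres Q p r s w (Comp Q p q r v u)"
  using assms
  by (intro le_antisym_by_le[of r s])
    (simp_all add: lres_closed comp_closed lres_adjoint[symmetric] comp_assoc
      comp_closed[of q r s])

lemma rres_comp:
  assumes "p \<in> Ob Q" "q \<in> Ob Q" "r \<in> Ob Q" "s \<in> Ob Q"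
    "u \<in> Arrows Q q r" "v \<in> Arrows Q r s" "w \<in> Arrows Q p s"
  shows "rres Q p q r u (rres Q p r s v w) = rres Q p q s (Comp Q q r s v u) w"
  using assms
  by (intro le_antisym_by_le[of p q])
    (simp_all add: rres_closed comp_closed rres_adjoint[symmetric] comp_assoc
      comp_closed[of p q r])

end

section \<open>Linear negation in a Girard quantaloid\<close>

context girard_quantaloid
begin

text \<open>This is linear negation; the endpoints are arguments because an arrow alone does not
  determine them.\<close>

definition perp :: "'o \<Rightarrow> 'o \<Rightarrow> 'a \<Rightarrow> 'a"
  where "perp p q u = lres Q p q p (d p) u"

lemma perp_closed: "\<lbrakk>p \<in> Ob Q; q \<in> Ob Q; u \<in> Arrows Q p q\<rbrakk> \<Longrightarrow> perp p q u \<in> Arrows Q q p"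
  unfolding perp_def by (intro lres_closed d_closed)

text \<open>Cyclicity exhibits negation as a residual on either side, so that both
  \<open>lres_comp\<close> and \<open>rres_comp\<close> can act on it.\<close>

lemma perp_eq_rres:
  "\<lbrakk>p \<in> Ob Q; q \<in> Ob Q; u \<in> Arrows Q p q\<rbrakk> \<Longrightarrow> perp p q u = rres Q q p q u (d q)"
  unfolding perp_def by (rule cyclic)

text \<open>Reading the outer negation as \<open>rres\<close> and the inner one as
  \<open>lres\<close> turns the claim into \<open>dualizing_right\<close>.\<close>

lemma perp_perp:
  assumes "p \<in> Ob Q" "q \<in> Ob Q" "u \<in> Arrows Q p q"
  shows "perp q p (perp p q u) = u"
  using assms dualizing_right[of p q u] by (simp add: perp_closed perp_eq_rres[of q p]) (simp add: perp_def)

text \<open>This is \<open>lres_comp\<close> at \<open>d p\<close>; its counterpart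
  \<open>rres_perp\<close> is \<open>rres_comp\<close> at \<open>d r\<close>.\<close>

lemma lres_perp:
  assumes "p \<in> Ob Q" "q \<in> Ob Q" "r \<in> Ob Q" "u \<in> Arrows Q p q" "t \<in> Arrows Q q r"
  shows "lres Q q r p (perp p q u) t = perp p r (Comp Q p q r t u)"
  unfolding perp_def using assms by (simp add: lres_comp d_closed)

lemma rres_perp:
  assumes "p \<in> Ob Q" "q \<in> Ob Q" "r \<in> Ob Q" "s \<in> Arrows Q p q" "v \<in> Arrows Q q r"
  shows "rres Q r p q s (perp q r v) = perp p r (Comp Q p q r v s)"
  using assms by (simp add: perp_eq_rres rres_comp d_closed comp_closed)

lemma perp_eq_iff:
  assumes "p \<in> Ob Q" "q \<in> Ob Q" "u \<in> Arrows Q p q" "v \<in> Arrows Q p q"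
  shows "perp p q u = perp p q v \<longleftrightarrow> u = v"
  using assms by (metis perp_perp)

abbreviation (input) chu :: "('o, 'a) arrow \<Rightarrow> ('o, 'a) arrow \<Rightarrow> 'a \<times> 'a \<Rightarrow> bool"
  where "chu \<equiv> \<lambda>(p, q, u) (p', q', v) (s, t). lres Q p p' q u s = rres Q p' q q' t v"

fun dual :: "('o, 'a) arrow \<Rightarrow> ('o, 'a) arrow"
  where "dual (p, q, u) = (q, p, perp p q u)"

text \<open>Replacing \<open>u\<close> by its double negation makes \<open>lres_perp\<close>
  applicable; \<open>rres_eq_perp\<close> does the same for \<open>v\<close>.\<close>

lemma lres_eq_perp:
  assumes "p \<in> Ob Q" "q \<in> Ob Q" "p' \<in> Ob Q" "u \<in> Arrows Q p q" "s \<in> Arrows Q p p'"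
  shows "lres Q p p' q u s = perp q p' (Comp Q q p p' s (perp p q u))"
  using lres_perp[of q p p' "perp p q u" s] assms by (simp add: perp_perp perp_closed)

lemma rres_eq_perp:
  assumes "q \<in> Ob Q" "p' \<in> Ob Q" "q' \<in> Ob Q" "v \<in> Arrows Q p' q'" "t \<in> Arrows Q q q'"
  shows "rres Q p' q q' t v = perp q p' (Comp Q q q' p' (perp p' q' v) t)"
  using rres_perp[of q q' p' t "perp p' q' v"] assms by (simp add: perp_perp perp_closed)

text \<open>Both residuals are negations of composites from \<open>q\<close> to \<open>p'\<close>,
  and negation is injective.\<close>

lemma chu_iff_commutes:
  assumes "p \<in> Ob Q" "q \<in> Ob Q" "p' \<in> Ob Q" "q' \<in> Ob Q"
    "u \<in> Arrows Q p q" "v \<in> Arrows Q p' q'" "s \<in> Arrows Q p p'" "t \<in> Arrows Q q q'"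
  shows "lres Q p p' q u s = rres Q p' q q' t v \<longleftrightarrow>
    Comp Q q q' p' (perp p' q' v) t = Comp Q q p p' s (perp p q u)"
proof -
  have "Comp Q q q' p' (perp p' q' v) t \<in> Arrows Q q p'" "Comp Q q p p' s (perp p q u) \<in> Arrows Q q p'"
    using assms by (simp_all add: comp_closed[of q q' p'] comp_closed[of q p p'] perp_closed)
  then show ?thesis
    using assms perp_eq_iff by (auto simp: lres_eq_perp rres_eq_perp)
qed

text \<open>Each closure property is translated by \<open>chu_iff_commutes\<close> into the one for
  commuting squares, with endpoints and components exchanged.\<close>

lemma arrow_condition_chu: "arrow_condition Q chu"
proof -
  interpret A: arrow_condition Q "commutes Q" by (rule arrow_condition_commutes)
  show ?thesis
  proof (unfold_locales, unfold split)
    show "lres Q p p q u (Ide Q p) = rres Q p q q (Ide Q q) u"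
      if "p \<in> Ob Q" "q \<in> Ob Q" "u \<in> Arrows Q p q" for p q u
      using that by (simp add: chu_iff_commutes id_closed comp_id_left comp_id_right perp_closed)
  next
    fix p q p' q' p'' q'' u v w s t s' t'
    assume O: "p \<in> Ob Q" "q \<in> Ob Q" "p' \<in> Ob Q" "q' \<in> Ob Q" "p'' \<in> Ob Q" "q'' \<in> Ob Q"
      and A: "u \<in> Arrows Q p q" "v \<in> Arrows Q p' q'" "w \<in> Arrows Q p'' q''"
        "s \<in> Arrows Q p p'" "t \<in> Arrows Q q q'" "s' \<in> Arrows Q p' p''" "t' \<in> Arrows Q q' q''"
      and "lres Q p p' q u s = rres Q p' q q' t v"
      and "lres Q p' p'' q' v s' = rres Q p'' q' q'' t' w"
    then show "lres Q p p'' q u (Comp Q p p' p'' s' s) = rres Q p'' q q'' (Comp Q q q' q'' t' t) w"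
      using A.P_comp[of q p q' p' q'' p'' "perp p q u" "perp p' q' v" "perp p'' q'' w" t s t' s']
      by (simp add: chu_iff_commutes perp_closed comp_closed[of p p' p''] comp_closed[of q q' q''])
  next
    fix p q p' q' u v S
    assume O: "p \<in> Ob Q" "q \<in> Ob Q" "p' \<in> Ob Q" "q' \<in> Ob Q"
      and A: "u \<in> Arrows Q p q" "v \<in> Arrows Q p' q'" and S: "S \<subseteq> Arrows Q p p' \<times> Arrows Q q q'"
      and P: "\<And>x. x \<in> S \<Longrightarrow> case x of (s, t) \<Rightarrow> lres Q p p' q u s = rres Q p' q q' t v"
    interpret X: complete_lattice "Hom Q p p'" using O by (intro hom_complete_lattice)
    interpret Y: complete_lattice "Hom Q q q'" using O by (intro hom_complete_lattice)
    have "fst ` S \<subseteq> Arrows Q p p'" "snd ` S \<subseteq> Arrows Q q q'" using S by auto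
    then have closed: "\<Squnion>\<^bsub>Hom Q p p'\<^esub> (fst ` S) \<in> Arrows Q p p'"
      "\<Squnion>\<^bsub>Hom Q q q'\<^esub> (snd ` S) \<in> Arrows Q q q'" by simp_all
    \<comment> \<open>The swapped family consists of squares between the negated objects, to which
      \<open>A.P_sup\<close> applies.\<close>
    have "prod.swap ` S \<subseteq> Arrows Q q q' \<times> Arrows Q p p'" using S by auto
    moreover have "commutes Q (q, p, perp p q u) (q', p', perp p' q' v) x"
      if "x \<in> prod.swap ` S" for x
    proof -
      obtain s t where st: "x = (t, s)" "(s, t) \<in> S"
        using \<open>x \<in> prod.swap ` S\<close> by (metis imageE swap_simp surj_pair)
      then have "s \<in> Arrows Q p p'" "t \<in> Arrows Q q q'" using S by auto
      then show ?thesis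
        using P[OF st(2)] chu_iff_commutes[OF O A] by (simp add: st(1))
    qed
    ultimately show "lres Q p p' q u (\<Squnion>\<^bsub>Hom Q p p'\<^esub> (fst ` S)) =
        rres Q p' q q' (\<Squnion>\<^bsub>Hom Q q q'\<^esub> (snd ` S)) v"
      using A.P_sup[of q p q' p' "perp p q u" "perp p' q' v" "prod.swap ` S"] O A closed
      by (simp add: chu_iff_commutes perp_closed image_image)
  qed
qed

sublocale A: arrow_condition Q "commutes Q"
  by (rule arrow_condition_commutes)

sublocale C: arrow_condition Q chu
  by (rule arrow_condition_chu)

section \<open>The duality functors\<close>

text \<open>For negated objects \<open>chu_iff_commutes\<close> speaks of double negations, which
  \<open>perp_perp\<close> turns back into the given square.\<close>

lemma dual_Arr_ChuCon: "is_functor (Arr Q) (ChuCon Q) dual (\<lambda>_ _. prod.swap)"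
  by (auto simp: is_functor_def Arr_def ChuCon_def perp_closed chu_iff_commutes perp_perp)

lemma dual_ChuCon_Arr: "is_functor (ChuCon Q) (Arr Q) dual (\<lambda>_ _. prod.swap)"
  by (auto simp: is_functor_def Arr_def ChuCon_def perp_closed chu_iff_commutes perp_perp)

lemma inverse_dual: "inverse_functors (Arr Q) (ChuCon Q) dual (\<lambda>_ _. prod.swap) dual (\<lambda>_ _. prod.swap)"
  by (auto simp: inverse_functors_def Arr_def ChuCon_def perp_perp)

lemma quantaloid_Arr: "quantaloid (Arr Q)"
  unfolding Arr_def by (rule A.quantaloid_arrow_pairs)

lemma quantaloid_ChuCon: "quantaloid (ChuCon Q)"
  unfolding ChuCon_def by (rule C.quantaloid_arrow_pairs)

lemma hom_dual_Arr_ChuCon: "quantaloid_homomorphism (Arr Q) (ChuCon Q) dual (\<lambda>_ _. prod.swap)"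
  unfolding quantaloid_homomorphism_def
proof (intro conjI ballI quantaloid_Arr quantaloid_ChuCon dual_Arr_ChuCon)
  fix a b assume O: "a \<in> Ob (Arr Q)" "b \<in> Ob (Arr Q)"
  show "sup_pres (Hom (Arr Q) a b) (Hom (ChuCon Q) (dual a) (dual b)) prod.swap"
    using O is_functor_closed[OF dual_Arr_ChuCon] unfolding Arr_def ChuCon_def
    by (cases a; cases b)
      (auto intro!: sup_pres_swap arrow_condition_commutes arrow_condition_chu simp: perp_closed)
qed

lemma hom_dual_ChuCon_Arr: "quantaloid_homomorphism (ChuCon Q) (Arr Q) dual (\<lambda>_ _. prod.swap)"
  unfolding quantaloid_homomorphism_def
proof (intro conjI ballI quantaloid_Arr quantaloid_ChuCon dual_ChuCon_Arr)
  fix a b assume O: "a \<in> Ob (ChuCon Q)" "b \<in> Ob (ChuCon Q)"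
  show "sup_pres (Hom (ChuCon Q) a b) (Hom (Arr Q) (dual a) (dual b)) prod.swap"
    using O is_functor_closed[OF dual_ChuCon_Arr] unfolding Arr_def ChuCon_def
    by (cases a; cases b)
      (auto intro!: sup_pres_swap arrow_condition_commutes arrow_condition_chu simp: perp_closed)
qed

section \<open>The two congruences under duality\<close>

text \<open>The outer two equations in \<open>ChuCon_cong\<close> are the Chu conditions. The
  remaining one is put in terms of \<open>snd\<close>, which swapping turns into the component
  tested in \<open>Arr_cong_iff\<close>.\<close>

lemma ChuCon_cong_iff:
  "(x, x') \<in> ChuCon_cong Q (p, q, u) (p', q', v) \<longleftrightarrow>
    x \<in> Arrows (ChuCon Q) (p, q, u) (p', q', v) \<and> x' \<in> Arrows (ChuCon Q) (p, q, u) (p', q', v) \<and>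
    rres Q p' q q' (snd x) v = rres Q p' q q' (snd x') v"
  by (cases x; cases x') (auto simp: ChuCon_cong_def ChuCon_def)

text \<open>The common residual of a Chu connection is the negation of the diagonal of its dual
  square, so injectivity of negation identifies the two relations.\<close>

lemma ChuCon_cong_iff_Arr_cong:
  assumes O: "a \<in> Ob (ChuCon Q)" "b \<in> Ob (ChuCon Q)"
    and x: "x \<in> Arrows (ChuCon Q) a b" "x' \<in> Arrows (ChuCon Q) a b"
  shows "(x, x') \<in> ChuCon_cong Q a b \<longleftrightarrow> (prod.swap x, prod.swap x') \<in> Arr_cong Q (dual a) (dual b)"
proof -
  obtain p q u p' q' v s t s' t'
    where eqs: "a = (p, q, u)" "b = (p', q', v)" "x = (s, t)" "x' = (s', t')"
    by (cases a; cases b; cases x; cases x')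
  have A: "p \<in> Ob Q" "q \<in> Ob Q" "p' \<in> Ob Q" "q' \<in> Ob Q" "v \<in> Arrows Q p' q'"
    "t \<in> Arrows Q q q'" "t' \<in> Arrows Q q q'"
    using O x by (simp_all add: eqs ChuCon_def)
  then have "Comp Q q q' p' (perp p' q' v) t \<in> Arrows Q q p'"
    "Comp Q q q' p' (perp p' q' v) t' \<in> Arrows Q q p'"
    by (simp_all add: comp_closed[of q q' p'] perp_closed)
  then have "rres Q p' q q' t v = rres Q p' q q' t' v \<longleftrightarrow>
      Comp Q q q' p' (perp p' q' v) t = Comp Q q q' p' (perp p' q' v) t'"
    using A by (simp add: rres_eq_perp perp_eq_iff)
  moreover have "(t, s) \<in> Arrows (Arr Q) (dual a) (dual b)" "(t', s') \<in> Arrows (Arr Q) (dual a) (dual b)"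
    using is_functor_closed(2)[OF dual_ChuCon_Arr O] x by (force simp: eqs)+
  ultimately show ?thesis
    using x by (simp add: eqs ChuCon_cong_iff Arr_cong_iff)
qed

text \<open>The relation is the pullback of \<open>Arr_cong\<close> along the duality
  homomorphism.\<close>

lemma congruence_ChuCon: "quantaloid_congruence (ChuCon Q) (ChuCon_cong Q)"
proof (rule congruence_pullback[OF congruence_Arr hom_dual_ChuCon_Arr])
  fix a b assume O: "a \<in> Ob (ChuCon Q)" "b \<in> Ob (ChuCon Q)"
  have *: "(x, x') \<in> ChuCon_cong Q a b \<longleftrightarrow>
      x \<in> Arrows (ChuCon Q) a b \<and> x' \<in> Arrows (ChuCon Q) a b \<and>
      (prod.swap x, prod.swap x') \<in> Arr_cong Q (dual a) (dual b)" for x x'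
  proof -
    have "x \<in> Arrows (ChuCon Q) a b \<and> x' \<in> Arrows (ChuCon Q) a b"
      if "(x, x') \<in> ChuCon_cong Q a b"
      using that by (cases a; cases b) (simp add: ChuCon_cong_iff)
    then show ?thesis
      using ChuCon_cong_iff_Arr_cong[OF O, of x x'] by metis
  qed
  show "ChuCon_cong Q a b = {(x, x') \<in> Arrows (ChuCon Q) a b \<times> Arrows (ChuCon Q) a b.
      (prod.swap x, prod.swap x') \<in> Arr_cong Q (dual a) (dual b)}"
    by (rule Set.set_eqI)
      (simp only: split_paired_all mem_Collect_eq prod.case mem_Times_iff fst_conv snd_conv
        conj_assoc *)
qed

text \<open>Apply \<open>ChuCon_cong_iff_Arr_cong\<close> to the dual objects and swapped pairs;
  dualizing twice returns the original data.\<close>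

lemma Arr_cong_dual_iff:
  assumes O: "a \<in> Ob (Arr Q)" "b \<in> Ob (Arr Q)"
    and "x \<in> Arrows (Arr Q) a b" "x' \<in> Arrows (Arr Q) a b"
  shows "(prod.swap x, prod.swap x') \<in> ChuCon_cong Q (dual a) (dual b) \<longleftrightarrow> (x, x') \<in> Arr_cong Q a b"
proof -
  have "dual (dual a) = a" "dual (dual b) = b"
    using inverse_dual O by (simp_all add: inverse_functors_def)
  then show ?thesis
    using ChuCon_cong_iff_Arr_cong[of "dual a" "dual b" "prod.swap x" "prod.swap x'"] assms
      is_functor_closed[OF dual_Arr_ChuCon] by auto
qed

end

theorem proposition8p2:
  fixes Q :: "('o, 'a) quantaloid_data" and d :: "'o \<Rightarrow> 'a"
  assumes "girard_quantaloid Q d"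
  shows "isomorphic_quantaloids (Arr Q) (ChuCon Q) \<and> isomorphic_quantaloids (DQ Q) (BQ Q)"
proof
  interpret girard_quantaloid Q d by fact
  show "isomorphic_quantaloids (Arr Q) (ChuCon Q)"
    unfolding isomorphic_quantaloids_def category_isomorphism_def
    using quantaloid_Arr quantaloid_ChuCon hom_dual_Arr_ChuCon dual_Arr_ChuCon dual_ChuCon_Arr
      inverse_dual by blast
  show "isomorphic_quantaloids (DQ Q) (BQ Q)"
    unfolding DQ_def BQ_def
    by (rule isomorphic_quotients[OF congruence_Arr congruence_ChuCon hom_dual_Arr_ChuCon
          dual_ChuCon_Arr inverse_dual Arr_cong_dual_iff])
qed

end
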